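(* Let $\Phi$ be an LWR frame, and for evaluation points $\lambda_0\ne\lambda_1\in\mathbb C$ let $f^{\mathbb H}=f^{\mathbb H}_{(\lambda_0,\lambda_1)}=\Psi^*\Psi$ with $\Psi=\Phi_{\lambda_1}\Phi_{\lambda_0}^{-1}$ be the CMC $1$ immersion into $\mathbb H^3$ induced by $\Phi$. The dual associated family of $f^{\mathbb H}$ is obtained by fixing $\lambda_0$ and moving $\lambda_1$.
   Context: Ambient space. $\mathcal H_2$: $2\times2$ Hermitian matrices with $\langle x,y\rangle=-\frac12\operatorname{tr}(x\widehat y)$ ($\widehat y$ the adjugate), extended complex-bilinearly. $\mathbb H^3=\{x\in\mathcal H_2:\det x=1,\operatorname{tr}x>0\}$, oriented so that at $\mathrm I$ (where the tangent space is the trace-free Hermitian matrices) $(x,y,-\frac i2[x,y])$ is positive, transported by the isometries $x\mapsto VxV^*$, $V\in \mathrm{SL}_2\mathbb C$. For a conformal immersion $f$: metric $ds^2=2\langle f_z,f_{\bar z}\rangle|dz|^2$, unit normal $N$ with $(f_x,f_y,N)$ positively oriented orthogonal, Hopf differential $Q\,dz^2$ and mean curvature $H$ defined by $-\langle df,dN\rangle=Q\,dz^2+H\,ds^2+\bar Q\,d\bar z^2$; CMC 1 means $H\equiv 1$. LWR potential: family $\xi_\lambda$ ($\lambda\in\mathbb C$) of meromorphic $\mathrm{sl}_2\mathbb C$-valued 1-forms on a Riemann surface, locally away from poles $\xi_\lambda=(A\lambda+B)dz$ with $A,B$ holomorphic in $z$ and $A$ nilpotent. LWR frame: $\mathrm{SL}_2\mathbb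 C$-valued $\Phi_\lambda$, holomorphic in $z$ and in $\lambda\in\mathbb C$, with $\Phi^{-1}d\Phi$ an LWR potential. Dual: for a conformal CMC 1 immersion $f=\Psi^*\Psi$, with $\Psi$ a holomorphic null curve into $\mathrm{SL}_2\mathbb C$ (holomorphic, $d\Psi$ nowhere zero, $\det d\Psi=0$), the dual is $f^\sharp=(\Psi^{-1})^*\Psi^{-1}$. Complex associated family $(f_\lambda)_{\lambda\in\mathbb C^*}$ of a CMC 1 immersion $f$ with metric $ds^2$ and Hopf differential $Q\,dz^2$: the family of CMC 1 immersions with metric $|\lambda|^2ds^2$ and Hopf differential $\lambda Q\,dz^2$, defined up to ambient isometries. Dual associated family of $f$: $\hat f_\lambda:=\big((f^\sharp)_\lambda\big)^\sharp$, $\lambda\in\mathbb C^*$. *)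

theory Defs
  imports "HOL-Complex_Analysis.Complex_Analysis"
begin

type_synonym cmat2 = "complex^2^2"

definition cscale :: "complex \<Rightarrow> cmat2 \<Rightarrow> cmat2" where
  "cscale c A = (\<chi> i j. c * A$i$j)"

definition adjoint_mat :: "cmat2 \<Rightarrow> cmat2" where
  "adjoint_mat A = (\<chi> i j. cnj (A$j$i))"

definition hermitian :: "cmat2 \<Rightarrow> bool" where
  "hermitian A \<longleftrightarrow> adjoint_mat A = A"

definition adjugate :: "cmat2 \<Rightarrow> cmat2" where
  "adjugate A = vector [vector [A$2$2, - A$1$2], vector [- A$2$1, A$1$1]]"

definition nilpotent_mat :: "cmat2 \<Rightarrow> bool" where
  "nilpotent_mat A \<longleftrightarrow> (\<exists>k. (((**) A) ^^ k) (mat 1) = 0)"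

text \<open>The Lorentzian product on Hermitian matrices, extended complex-bilinearly; the
  complexification of the Hermitian matrices is the space of all complex matrices.\<close>

definition form :: "cmat2 \<Rightarrow> cmat2 \<Rightarrow> complex" where
  "form x y = - (1/2) * trace (x ** adjugate y)"

definition H3 :: "cmat2 set" where
  "H3 = {x. hermitian x \<and> det x = 1 \<and> Re (trace x) > 0}"

text \<open>Three trace-free Hermitian matrices form a positive basis of the tangent space at the
  identity if the change of basis from \<open>(x, y, -(\<i>/2)[x,y])\<close> has positive determinant; for
  a basis with the same first two vectors this determinant is the coefficient \<open>c\<close> below.\<close>

definition positive_at_one :: "cmat2 \<Rightarrow> cmat2 \<Rightarrow> cmat2 \<Rightarrow> bool" where
  "positive_at_one x y n \<longleftrightarrow>
     (\<forall>v\<in>{x, y, n}. hermitian v \<and> trace v = 0) \<and>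
     (\<forall>a b :: real. a *\<^sub>R x + b *\<^sub>R y = 0 \<longrightarrow> a = 0 \<and> b = 0) \<and>
     (\<exists>a b c :: real. c > 0 \<and>
        n = a *\<^sub>R x + b *\<^sub>R y + c *\<^sub>R cscale (- (\<i>/2)) (x ** y - y ** x))"

text \<open>Transport by \<open>x \<mapsto> V x V*\<close>. The choice of \<open>V\<close> is immaterial, since two choices differ
  by an element of the connected group SU(2).\<close>

definition positively_oriented :: "cmat2 \<Rightarrow> cmat2 \<Rightarrow> cmat2 \<Rightarrow> cmat2 \<Rightarrow> bool" where
  "positively_oriented p u v w \<longleftrightarrow>
     (\<exists>V x y n. det V = 1 \<and> p = V ** adjoint_mat V \<and> positive_at_one x y n \<and>
        u = V ** x ** adjoint_mat V \<and> v = V ** y ** adjoint_mat V \<and>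
        w = V ** n ** adjoint_mat V)"


section \<open>Riemann surfaces\<close>

text \<open>A chart is a pair of an open set and a coordinate map on it.\<close>

type_synonym 'a chart = "'a set \<times> ('a \<Rightarrow> complex)"

definition chart_image :: "'a chart \<Rightarrow> complex set" where
  "chart_image c = snd c ` fst c"

definition in_chart :: "'a chart \<Rightarrow> ('a \<Rightarrow> 'b) \<Rightarrow> complex \<Rightarrow> 'b" where
  "in_chart c g = g \<circ> the_inv_into (fst c) (snd c)"

definition riemann_surface :: "'a topology \<Rightarrow> 'a chart set \<Rightarrow> bool" where
  "riemann_surface X \<A> \<longleftrightarrow>
     Hausdorff_space X \<and> connected_space X \<and>
     (\<Union>c\<in>\<A>. fst c) = topspace X \<and>
     (\<forall>c\<in>\<A>. openin X (fst c) \<and> open (chart_image c) \<and>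
        homeomorphic_map (subtopology X (fst c)) (top_of_set (chart_image c)) (snd c)) \<and>
     (\<forall>c\<in>\<A>. \<forall>d\<in>\<A>. in_chart c (snd d) holomorphic_on snd c ` (fst c \<inter> fst d))"


section \<open>Conformal immersions into hyperbolic space\<close>

text \<open>In a coordinate \<open>z = x + \<i> y\<close>, with \<open>F\<close> defined on an open subset of the plane.\<close>

definition dx :: "(complex \<Rightarrow> 'b::real_normed_vector) \<Rightarrow> complex \<Rightarrow> 'b" where
  "dx F z = frechet_derivative F (at z) 1"

definition dy :: "(complex \<Rightarrow> 'b::real_normed_vector) \<Rightarrow> complex \<Rightarrow> 'b" where
  "dy F z = frechet_derivative F (at z) \<i>"

definition dz :: "(complex \<Rightarrow> cmat2) \<Rightarrow> complex \<Rightarrow> cmat2" where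
  "dz F z = cscale (1/2) (dx F z - cscale \<i> (dy F z))"

definition dzbar :: "(complex \<Rightarrow> cmat2) \<Rightarrow> complex \<Rightarrow> cmat2" where
  "dzbar F z = cscale (1/2) (dx F z + cscale \<i> (dy F z))"

fun Ck_on :: "nat \<Rightarrow> (complex \<Rightarrow> 'b::real_normed_vector) \<Rightarrow> complex set \<Rightarrow> bool" where
  "Ck_on 0 F D \<longleftrightarrow> continuous_on D F"
| "Ck_on (Suc k) F D \<longleftrightarrow>
     (\<forall>z\<in>D. F differentiable (at z)) \<and> Ck_on k (dx F) D \<and> Ck_on k (dy F) D"

definition immersion_on :: "(complex \<Rightarrow> cmat2) \<Rightarrow> complex set \<Rightarrow> bool" where
  "immersion_on F D \<longleftrightarrow>
     (\<forall>k. Ck_on k F D) \<and> (\<forall>z\<in>D. inj (frechet_derivative F (at z)))"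

definition conformal_on :: "(complex \<Rightarrow> cmat2) \<Rightarrow> complex set \<Rightarrow> bool" where
  "conformal_on F D \<longleftrightarrow>
     (\<forall>z\<in>D. form (dx F z) (dx F z) = form (dy F z) (dy F z) \<and> form (dx F z) (dy F z) = 0)"

text \<open>The induced metric is \<open>ds^2 = metric_coeff F z * |dz|^2\<close>.\<close>

definition metric_coeff :: "(complex \<Rightarrow> cmat2) \<Rightarrow> complex \<Rightarrow> complex" where
  "metric_coeff F z = 2 * form (dz F z) (dzbar F z)"

definition unit_normal :: "(complex \<Rightarrow> cmat2) \<Rightarrow> complex \<Rightarrow> cmat2" where
  "unit_normal F z = (THE n. hermitian n \<and> form n n = 1 \<and> form n (F z) = 0 \<and>
     form n (dx F z) = 0 \<and> form n (dy F z) = 0 \<and>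
     positively_oriented (F z) (dx F z) (dy F z) n)"

text \<open>The identity \<open>-<dF,dN> = Q dz^2 + H ds^2 + cnj Q dzbar^2\<close> of quadratic forms at \<open>z\<close>,
  evaluated on the tangent vector \<open>v\<close>.\<close>

definition second_form_eq :: "(complex \<Rightarrow> cmat2) \<Rightarrow> complex \<Rightarrow> complex \<Rightarrow> real \<Rightarrow> bool" where
  "second_form_eq F z Q H \<longleftrightarrow>
     (\<forall>v. - form (frechet_derivative F (at z) v) (frechet_derivative (unit_normal F) (at z) v) =
        Q * v^2 + of_real H * (metric_coeff F z * of_real ((cmod v)^2)) + cnj Q * (cnj v)^2)"

definition hopf_coeff :: "(complex \<Rightarrow> cmat2) \<Rightarrow> complex \<Rightarrow> complex" where
  "hopf_coeff F z = (THE Q. \<exists>H. second_form_eq F z Q H)"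

definition mean_curvature :: "(complex \<Rightarrow> cmat2) \<Rightarrow> complex \<Rightarrow> real" where
  "mean_curvature F z = (THE H. \<exists>Q. second_form_eq F z Q H)"

definition immersion :: "'a chart set \<Rightarrow> ('a \<Rightarrow> cmat2) \<Rightarrow> bool" where
  "immersion \<A> f \<longleftrightarrow> (\<forall>c\<in>\<A>. immersion_on (in_chart c f) (chart_image c))"

definition cmc1_immersion :: "'a topology \<Rightarrow> 'a chart set \<Rightarrow> ('a \<Rightarrow> cmat2) \<Rightarrow> bool" where
  "cmc1_immersion X \<A> f \<longleftrightarrow>
     f ` topspace X \<subseteq> H3 \<and> immersion \<A> f \<and>
     (\<forall>c\<in>\<A>. conformal_on (in_chart c f) (chart_image c) \<and>
        (\<forall>z\<in>chart_image c.
           unit_normal (in_chart c f) differentiable (at z) \<and>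
           (\<exists>Q. second_form_eq (in_chart c f) z Q 1) \<and>
           mean_curvature (in_chart c f) z = 1))"


section \<open>LWR frames\<close>

definition mderiv :: "(complex \<Rightarrow> cmat2) \<Rightarrow> complex \<Rightarrow> cmat2" where
  "mderiv M z = (\<chi> i j. deriv (\<lambda>w. M w $ i $ j) z)"

text \<open>The family \<open>\<xi>\<close> consists of the coefficients, in a coordinate ranging over \<open>D\<close>, of
  1-forms \<open>\<xi> l z dz\<close>. The points of \<open>P\<close> are the poles.\<close>

definition lwr_potential_on ::
    "complex set \<Rightarrow> (complex \<Rightarrow> complex \<Rightarrow> cmat2) \<Rightarrow> bool" where
  "lwr_potential_on D \<xi> \<longleftrightarrow>
     (\<forall>l i j. (\<lambda>z. \<xi> l z $ i $ j) meromorphic_on D) \<and>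
     (let P = {z\<in>D. \<exists>l i j. \<not> (\<lambda>z. \<xi> l z $ i $ j) analytic_on {z}} in
        P sparse_in D \<and>
        (\<forall>z0\<in>D - P. \<exists>U A B. open U \<and> z0 \<in> U \<and> U \<subseteq> D \<and>
           (\<forall>i j. (\<lambda>z. A z $ i $ j) holomorphic_on U \<and> (\<lambda>z. B z $ i $ j) holomorphic_on U) \<and>
           (\<forall>z\<in>U. nilpotent_mat (A z) \<and>
              (\<forall>l. trace (\<xi> l z) = 0 \<and> \<xi> l z = cscale l (A z) + B z))))"

text \<open>The forms \<open>\<Phi>^{-1} d\<Phi>\<close> are given by a function on the surface, so the transformation
  rule under change of charts holds automatically, and the conditions on a potential do not
  depend on the chart.\<close>

definition lwr_frame :: "'a topology \<Rightarrow> 'a chart set \<Rightarrow> (complex \<Rightarrow> 'a \<Rightarrow> cmat2) \<Rightarrow> bool" where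
  "lwr_frame X \<A> \<Phi> \<longleftrightarrow>
     (\<forall>l. \<forall>p\<in>topspace X. det (\<Phi> l p) = 1) \<and>
     (\<forall>p\<in>topspace X. \<forall>i j. (\<lambda>l. \<Phi> l p $ i $ j) holomorphic_on UNIV) \<and>
     (\<forall>c\<in>\<A>.
        (\<forall>l i j. (\<lambda>z. in_chart c (\<Phi> l) z $ i $ j) holomorphic_on chart_image c) \<and>
        lwr_potential_on (chart_image c)
          (\<lambda>l z. matrix_inv (in_chart c (\<Phi> l) z) ** mderiv (in_chart c (\<Phi> l)) z))"

definition induced_surface ::
    "(complex \<Rightarrow> 'a \<Rightarrow> cmat2) \<Rightarrow> complex \<Rightarrow> complex \<Rightarrow> 'a \<Rightarrow> cmat2" where
  "induced_surface \<Phi> l0 l1 p =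
     (let \<Psi> = \<Phi> l1 p ** matrix_inv (\<Phi> l0 p) in adjoint_mat \<Psi> ** \<Psi>)"


section \<open>Duals and associated families\<close>

definition null_curve :: "'a topology \<Rightarrow> 'a chart set \<Rightarrow> ('a \<Rightarrow> cmat2) \<Rightarrow> bool" where
  "null_curve X \<A> \<Psi> \<longleftrightarrow>
     (\<forall>p\<in>topspace X. det (\<Psi> p) = 1) \<and>
     (\<forall>c\<in>\<A>. (\<forall>i j. (\<lambda>z. in_chart c \<Psi> z $ i $ j) holomorphic_on chart_image c) \<and>
        (\<forall>z\<in>chart_image c.
           mderiv (in_chart c \<Psi>) z \<noteq> 0 \<and> det (mderiv (in_chart c \<Psi>) z) = 0))"

text \<open>\<open>g\<close> is a dual of \<open>f\<close>. A relation, since the null curve of \<open>f\<close> is unique only up to left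
  multiplication by a constant unitary matrix, so that the dual is unique up to isometry.\<close>

definition is_dual ::
    "'a topology \<Rightarrow> 'a chart set \<Rightarrow> ('a \<Rightarrow> cmat2) \<Rightarrow> ('a \<Rightarrow> cmat2) \<Rightarrow> bool" where
  "is_dual X \<A> f g \<longleftrightarrow>
     cmc1_immersion X \<A> f \<and>
     (\<exists>\<Psi>. null_curve X \<A> \<Psi> \<and>
        (\<forall>p\<in>topspace X. f p = adjoint_mat (\<Psi> p) ** \<Psi> p \<and>
           g p = adjoint_mat (matrix_inv (\<Psi> p)) ** matrix_inv (\<Psi> p)))"

text \<open>\<open>F\<close> is a representative of the complex associated family of \<open>f\<close>: each \<open>F \<mu>\<close> is determined
  by its metric and Hopf differential up to an ambient isometry depending on \<open>\<mu>\<close>, and every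
  choice of these isometries is admitted. The value \<open>F 0\<close> is irrelevant.\<close>

definition complex_associated_family ::
    "'a topology \<Rightarrow> 'a chart set \<Rightarrow> ('a \<Rightarrow> cmat2) \<Rightarrow> (complex \<Rightarrow> 'a \<Rightarrow> cmat2) \<Rightarrow> bool" where
  "complex_associated_family X \<A> f F \<longleftrightarrow>
     cmc1_immersion X \<A> f \<and>
     (\<forall>\<mu>. \<mu> \<noteq> 0 \<longrightarrow> cmc1_immersion X \<A> (F \<mu>) \<and>
        (\<forall>c\<in>\<A>. \<forall>z\<in>chart_image c.
           metric_coeff (in_chart c (F \<mu>)) z =
             of_real ((cmod \<mu>)^2) * metric_coeff (in_chart c f) z \<and>
           hopf_coeff (in_chart c (F \<mu>)) z = \<mu> * hopf_coeff (in_chart c f) z))"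

definition dual_associated_family ::
    "'a topology \<Rightarrow> 'a chart set \<Rightarrow> ('a \<Rightarrow> cmat2) \<Rightarrow> (complex \<Rightarrow> 'a \<Rightarrow> cmat2) \<Rightarrow> bool" where
  "dual_associated_family X \<A> f F \<longleftrightarrow>
     (\<exists>g G. is_dual X \<A> f g \<and> complex_associated_family X \<A> g G \<and>
        (\<forall>\<mu>. \<mu> \<noteq> 0 \<longrightarrow> is_dual X \<A> (G \<mu>) (F \<mu>)))"

end

theory Submission
  imports Defs
begin

text \<open>A null curve \<open>\<Psi>\<close> is governed by its logarithmic derivative \<open>a = \<Psi>' \<Psi>\<^sup>-\<^sup>1\<close>, which is
  trace-free because \<open>det \<Psi> = 1\<close>, singular because the curve is null, and hence of square
  zero. The surface \<open>f = \<Psi>* \<Psi>\<close> has conformal factor \<open>2 <a, a*>\<close> and normal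
  \<open>\<Psi>'* \<Psi>' / <a, a*> - f\<close>. Since the bilinear form polarises the determinant, matrices
  sharing a singular factor on the same side are orthogonal; this removes all mixed terms
  from the second fundamental form except the one of \<open>- f\<close>, which is the metric. So \<open>f\<close> has mean curvature
  1 (\<open>second_form_F\<close>, \<open>null_curve_cmc1_immersion\<close>). Its Hopf differential is
  \<open>- <a, a* a'> / <a, a*>\<close> (\<open>hopf_log_deriv\<close>), and replacing \<open>a\<close> by \<open>\<mu> a\<close>
  therefore multiplies the metric by \<open>\<bar>\<mu>\<bar>\<^sup>2\<close> and the Hopf differential by \<open>\<mu>\<close> (\<open>complex_scaling\<close>).

  For a frame with potential \<open>A \<lambda> + B\<close>, the curve \<open>\<Phi>\<^sub>t \<Phi>\<^sub>s\<^sup>-\<^sup>1\<close> has the logarithmic derivative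
  \<open>(t - s) \<Phi>\<^sub>t A \<Phi>\<^sub>t\<^sup>-\<^sup>1\<close> (\<open>log_deriv_curve\<close>). It is a null curve wherever \<open>A \<noteq> 0\<close>, and the
  immersion assumption excludes zeros of \<open>A\<close>. The dual of the surface induced at
  \<open>(\<lambda>\<^sub>0, \<lambda>\<^sub>1)\<close> belongs to the inverse curve \<open>\<Phi>\<^sub>s \<Phi>\<^sub>t\<^sup>-\<^sup>1\<close> with \<open>s = \<lambda>\<^sub>0\<close>, \<open>t = \<lambda>\<^sub>1\<close>, that is, to the
  pair with the two points exchanged, whose logarithmic derivative is
  \<open>(\<lambda>\<^sub>0 - \<lambda>\<^sub>1) \<Phi>\<^sub>s A \<Phi>\<^sub>s\<^sup>-\<^sup>1\<close>. Here \<open>\<lambda>\<^sub>1\<close> occurs in the scalar factor only. Moving it to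
  \<open>\<lambda>\<^sub>0 + \<mu> (\<lambda>\<^sub>1 - \<lambda>\<^sub>0)\<close> multiplies the logarithmic derivative by \<open>\<mu>\<close> and so runs through the
  associated family of the dual; dualising again exchanges the points back.\<close>

\<comment> \<open>Reading \<open>$\<close> also as a coefficient of a power series makes every matrix entry ambiguous.\<close>
no_notation fps_nth (infixl "$" 75)


section \<open>Two-by-two matrices\<close>

lemma mat2_eq_iff:
  fixes A B :: "'a^2^2"
  shows "A = B \<longleftrightarrow> A$1$1 = B$1$1 \<and> A$1$2 = B$1$2 \<and> A$2$1 = B$2$1 \<and> A$2$2 = B$2$2"
  by (auto simp: vec_eq_iff forall_2)

lemma mult_entries:
  fixes A B :: "'a::semiring_1^2^2"
  shows "(A ** B)$i$j = A$i$1 * B$1$j + A$i$2 * B$2$j"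
  by (simp add: matrix_matrix_mult_def sum_2)

lemma cscale_entries: "cscale c A $ i $ j = c * A$i$j"
  by (simp add: cscale_def)

lemma adjoint_entries: "adjoint_mat A $ i $ j = cnj (A$j$i)"
  by (simp add: adjoint_mat_def)

lemma adjugate_entries:
  "adjugate A $1$1 = A$2$2" "adjugate A $1$2 = - A$1$2"
  "adjugate A $2$1 = - A$2$1" "adjugate A $2$2 = A$1$1"
  by (simp_all add: adjugate_def)

lemma mat_one_entries:
  "(mat 1 :: 'a::zero_neq_one^2^2)$1$1 = 1" "(mat 1 :: 'a^2^2)$1$2 = 0"
  "(mat 1 :: 'a^2^2)$2$1 = 0" "(mat 1 :: 'a^2^2)$2$2 = 1"
  by (simp_all add: mat_def)

lemma trace_2: "trace (A :: 'a::semiring_1^2^2) = A$1$1 + A$2$2"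
  by (simp add: trace_def sum_2)

lemmas entries = mult_entries cscale_entries adjoint_entries adjugate_entries
  mat_one_entries trace_2 det_2

lemma cscale_cscale [simp]: "cscale a (cscale b M) = cscale (a * b) M"
  by (simp add: mat2_eq_iff entries)

lemma cscale_one [simp]: "cscale 1 M = M"
  by (simp add: mat2_eq_iff entries)

lemma cscale_zero [simp]: "cscale 0 M = 0" "cscale c 0 = 0"
  by (simp_all add: mat2_eq_iff entries)

lemma cscale_eq_0_iff: "cscale c M = 0 \<longleftrightarrow> c = 0 \<or> M = 0"
  by (auto simp: mat2_eq_iff entries)

lemma cscale_of_real: "cscale (of_real r) M = r *\<^sub>R M"
  by (simp add: mat2_eq_iff entries) (simp add: scaleR_conv_of_real)

lemma mult_cscale: "M ** cscale c N = cscale c (M ** N)" "cscale c M ** N = cscale c (M ** N)"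
  by (simp_all add: mat2_eq_iff entries algebra_simps)

lemma mult_uminus:
  fixes M N :: cmat2
  shows "M ** (- N) = - (M ** N)" "(- M) ** N = - (M ** N)"
  by (simp_all add: mat2_eq_iff entries)

lemma mult_distribs:
  fixes M N K :: cmat2
  shows "M ** (N + K) = M ** N + M ** K" "(M + N) ** K = M ** K + N ** K"
    "M ** (N - K) = M ** N - M ** K" "(M - N) ** K = M ** K - N ** K"
  by (simp_all add: mat2_eq_iff entries algebra_simps)

lemma adjoint_adjoint [simp]: "adjoint_mat (adjoint_mat M) = M"
  by (simp add: mat2_eq_iff entries)

lemma adjoint_mult: "adjoint_mat (M ** N) = adjoint_mat N ** adjoint_mat M"
  by (simp add: mat2_eq_iff entries algebra_simps)

lemma adjoint_cscale: "adjoint_mat (cscale c M) = cscale (cnj c) (adjoint_mat M)"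
  by (simp add: mat2_eq_iff entries)

lemma adjoint_add: "adjoint_mat (M + N) = adjoint_mat M + adjoint_mat N"
  by (simp add: mat2_eq_iff entries)

lemma det_adjoint: "det (adjoint_mat M) = cnj (det M)"
  by (simp add: entries algebra_simps)

lemma det_cscale: "det (cscale c M) = c^2 * det M"
  by (simp add: entries algebra_simps power2_eq_square)

lemma adjugate_adjugate [simp]: "adjugate (adjugate M) = M"
  by (simp add: mat2_eq_iff entries)

lemma adjugate_mult: "adjugate (M ** N) = adjugate N ** adjugate M"
  by (simp add: mat2_eq_iff entries algebra_simps)

lemma det_adjugate: "det (adjugate M) = det M"
  by (simp add: entries algebra_simps)

lemma adjugate_inverse:
  assumes "det M = 1"
  shows "adjugate M ** M = mat 1" "M ** adjugate M = mat 1"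
  using assms by (simp_all add: mat2_eq_iff entries algebra_simps)

lemma matrix_inv_eq_adjugate:
  assumes "det M = 1"
  shows "matrix_inv M = adjugate M"
proof -
  have "M ** matrix_inv M = mat 1 \<and> matrix_inv M ** M = mat 1"
    unfolding matrix_inv_def by (rule someI_ex) (use adjugate_inverse[OF assms] in blast)
  then show ?thesis
    using adjugate_inverse(1)[OF assms] by (metis matrix_mul_assoc matrix_mul_lid matrix_mul_rid)
qed

lemma tracefree_entry:
  fixes M :: cmat2
  assumes "trace M = 0"
  shows "M$2$2 = - M$1$1"
  using assms unfolding trace_2 by (metis add_eq_0_iff)

lemma adjugate_tracefree: "trace M = 0 \<Longrightarrow> adjugate M = - M"
  using tracefree_entry[of M] by (simp add: mat2_eq_iff entries)

lemma square_zero_2: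
  fixes M :: cmat2
  assumes "trace M = 0" "det M = 0"
  shows "M ** M = 0"
  using tracefree_entry[OF assms(1)] assms(2)
  by (simp add: mat2_eq_iff entries algebra_simps) (metis add.right_inverse add.commute)

text \<open>Determinants are multiplicative, so a power of the determinant of a nilpotent matrix
  vanishes.\<close>

lemma nilpotent_mat_det:
  assumes "nilpotent_mat M"
  shows "det M = 0"
proof -
  have "det ((((**) M) ^^ k) (mat 1)) = det M ^ k" for k
    by (induction k) (simp_all add: det_mul)
  moreover obtain k where "(((**) M) ^^ k) (mat 1) = 0"
    using assms by (auto simp: nilpotent_mat_def)
  moreover have "det (0 :: cmat2) = 0"
    by (simp add: det_2)
  ultimately have "det M ^ k = 0"
    by metis
  then show ?thesis
    by simp
qed

subsection \<open>The bilinear form\<close>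

lemma form_entries:
  "form x y = - (x$1$1 * y$2$2 - x$1$2 * y$2$1 - x$2$1 * y$1$2 + x$2$2 * y$1$1) / 2"
  by (simp add: form_def entries algebra_simps)

lemma form_bilinear:
  "form (x + y) w = form x w + form y w" "form w (x + y) = form w x + form w y"
  "form (x - y) w = form x w - form y w" "form w (x - y) = form w x - form w y"
  "form (- x) w = - form x w" "form w (- x) = - form w x"
  "form (cscale c x) w = c * form x w" "form w (cscale c x) = c * form w x"
  by (simp_all add: form_entries entries field_simps)

lemma form_zero [simp]: "form 0 w = 0" "form w 0 = 0"
  by (simp_all add: form_entries)

lemma form_commute: "form x y = form y x"
  by (simp add: form_entries algebra_simps)

lemma form_self: "form x x = - det x"
  by (simp add: form_entries entries field_simps)

text \<open>Since \<open>form x x = - det x\<close>, the bilinear form is the polarisation of the determinant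
  and inherits its multiplicativity in left and right factors. For \<open>det M = 1\<close> this says
  that \<open>x \<mapsto> M x M*\<close> is an isometry; for \<open>det M = 0\<close> it says that all matrices with the
  common singular factor \<open>M\<close> on the same side are orthogonal to each other, which is what
  makes the mean curvature of a null curve's surface constant.\<close>

lemma form_mult_left: "form (M ** x) (M ** y) = det M * form x y"
  by (simp add: form_entries entries field_simps)

lemma form_mult_right: "form (x ** M) (y ** M) = form x y * det M"
  by (simp add: form_entries entries field_simps)

lemma form_adjoint: "form (adjoint_mat x) (adjoint_mat y) = cnj (form x y)"
  by (simp add: form_entries entries field_simps)

lemma norm_mat2_squared:
  fixes M :: cmat2
  shows "complex_of_real ((norm M)\<^sup>2) =
    M$1$1 * cnj (M$1$1) + M$1$2 * cnj (M$1$2) + M$2$1 * cnj (M$2$1) + M$2$2 * cnj (M$2$2)"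
proof -
  have "(norm M)\<^sup>2 =
      (cmod (M$1$1))\<^sup>2 + (cmod (M$1$2))\<^sup>2 + (cmod (M$2$1))\<^sup>2 + (cmod (M$2$2))\<^sup>2"
    by (simp add: norm_vec_def L2_set_def sum_2)
  then show ?thesis
    by (simp only: of_real_add complex_norm_square)
qed

text \<open>For trace-free \<open>a\<close> the product with the adjoint is a positive multiple of the squared
  norm. On trace-free Hermitian matrices, the tangent space of hyperbolic space at the
  identity, the form is therefore positive definite.\<close>

lemma form_adjoint_self:
  assumes "trace a = 0"
  shows "form a (adjoint_mat a) = of_real ((norm a)\<^sup>2 / 2)"
  unfolding of_real_divide norm_mat2_squared
  by (simp add: form_entries entries tracefree_entry[OF assms])

lemma trace_adjoint_mult_self: "trace (adjoint_mat M ** M) = of_real ((norm M)\<^sup>2)"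
  unfolding norm_mat2_squared by (simp add: entries algebra_simps)

lemma trace_adjoint: "trace (adjoint_mat M) = cnj (trace M)"
  by (simp add: entries)

lemma form_one: "form M (mat 1) = - trace M / 2"
  by (simp add: form_entries entries)

text \<open>This turns the commutator \<open>[a, a*]\<close>, which gives the direction of the normal, into
  a linear combination of \<open>a* a\<close> and the identity.\<close>

lemma tracefree_anticommutator:
  assumes "trace a = 0"
  shows "a ** adjoint_mat a + adjoint_mat a ** a = cscale (2 * form a (adjoint_mat a)) (mat 1)"
  by (simp add: mat2_eq_iff form_entries entries tracefree_entry[OF assms] algebra_simps)

lemma H3_adjoint_mult:
  assumes "det M = 1"
  shows "adjoint_mat M ** M \<in> H3"
proof -
  have "M \<noteq> 0"
    using assms by (auto simp: entries)
  then have "Re (trace (adjoint_mat M ** M)) > 0"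
    by (simp add: trace_adjoint_mult_self)
  then show ?thesis
    using assms by (simp add: H3_def hermitian_def adjoint_mult det_mul det_adjoint)
qed

section \<open>Calculus of matrix-valued functions\<close>

definition holomorphic_mat :: "(complex \<Rightarrow> cmat2) \<Rightarrow> complex set \<Rightarrow> bool" where
  "holomorphic_mat M D \<longleftrightarrow> (\<forall>i j. (\<lambda>z. M z $ i $ j) holomorphic_on D)"

lemma holomorphic_mat_iff:
  "holomorphic_mat M D \<longleftrightarrow>
     (\<lambda>z. M z $ 1 $ 1) holomorphic_on D \<and> (\<lambda>z. M z $ 1 $ 2) holomorphic_on D \<and>
     (\<lambda>z. M z $ 2 $ 1) holomorphic_on D \<and> (\<lambda>z. M z $ 2 $ 2) holomorphic_on D"
  by (auto simp: holomorphic_mat_def forall_2)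

lemma holomorphic_mat_mult:
  "holomorphic_mat M D \<Longrightarrow> holomorphic_mat N D \<Longrightarrow> holomorphic_mat (\<lambda>z. M z ** N z) D"
  by (auto simp: holomorphic_mat_def entries intro!: holomorphic_intros)

lemma holomorphic_mat_cscale:
  "holomorphic_mat M D \<Longrightarrow> holomorphic_mat (\<lambda>z. cscale c (M z)) D"
  by (auto simp: holomorphic_mat_def entries intro!: holomorphic_intros)

lemma holomorphic_mat_adjugate:
  "holomorphic_mat M D \<Longrightarrow> holomorphic_mat (\<lambda>z. adjugate (M z)) D"
  by (auto simp: holomorphic_mat_iff entries intro!: holomorphic_intros)

lemma holomorphic_mat_mderiv:
  "open D \<Longrightarrow> holomorphic_mat M D \<Longrightarrow> holomorphic_mat (mderiv M) D"
  by (auto simp: holomorphic_mat_def mderiv_def intro!: holomorphic_deriv)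

lemma holomorphic_mat_cong:
  "(\<And>z. z \<in> D \<Longrightarrow> M z = N z) \<Longrightarrow> holomorphic_mat M D \<longleftrightarrow> holomorphic_mat N D"
  unfolding holomorphic_mat_def by (intro all_cong1 holomorphic_cong) auto

lemma mderiv_entries: "mderiv M z $ i $ j = deriv (\<lambda>w. M w $ i $ j) z"
  by (simp add: mderiv_def)

lemma mderiv_cong:
  assumes "open D" "z \<in> D" "\<And>w. w \<in> D \<Longrightarrow> M w = N w"
  shows "mderiv M z = mderiv N z"
proof -
  have "\<forall>\<^sub>F w in nhds z. M w = N w"
    using assms eventually_nhds by blast
  then have "deriv (\<lambda>w. M w $ i $ j) z = deriv (\<lambda>w. N w $ i $ j) z" for i j
    by (intro deriv_cong_ev) (auto elim: eventually_mono)
  then show ?thesis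
    by (simp add: mderiv_def)
qed

lemma has_field_derivative_mderiv:
  assumes "open D" "z \<in> D" "holomorphic_mat M D"
  shows "((\<lambda>w. M w $ i $ j) has_field_derivative mderiv M z $ i $ j) (at z)"
  using assms holomorphic_derivI[of "\<lambda>w. M w $ i $ j" D z UNIV]
  by (simp add: holomorphic_mat_def mderiv_entries)

lemma mderiv_eqI:
  assumes "\<And>i j. ((\<lambda>w. M w $ i $ j) has_field_derivative M' $ i $ j) (at z)"
  shows "mderiv M z = M'"
  using assms by (simp add: vec_eq_iff mderiv_entries DERIV_imp_deriv)

lemma mderiv_mult:
  assumes "open D" "z \<in> D" "holomorphic_mat M D" "holomorphic_mat N D"
  shows "mderiv (\<lambda>w. M w ** N w) z = mderiv M z ** N z + M z ** mderiv N z"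
  using has_field_derivative_mderiv[OF assms(1-3)] has_field_derivative_mderiv[OF assms(1,2,4)]
  by (intro mderiv_eqI) (auto simp: entries intro!: derivative_eq_intros)

lemma mderiv_adjugate:
  assumes "open D" "z \<in> D" "holomorphic_mat M D"
  shows "mderiv (\<lambda>w. adjugate (M w)) z = adjugate (mderiv M z)"
proof -
  have "((\<lambda>w. adjugate (M w) $ i $ j) has_field_derivative adjugate (mderiv M z) $ i $ j) (at z)"
    for i j
    using has_field_derivative_mderiv[OF assms] exhaust_2[of i] exhaust_2[of j]
    by (auto simp: entries intro!: derivative_intros)
  then show ?thesis
    by (rule mderiv_eqI)
qed

lemma has_derivative_matI:
  fixes F :: "complex \<Rightarrow> cmat2"
  assumes "\<And>i j. ((\<lambda>w. F w $ i $ j) has_derivative (\<lambda>v. F' v $ i $ j)) (at z)"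
  shows "(F has_derivative F') (at z)"
  unfolding has_derivative_componentwise_within[of F]
  by (auto simp: Basis_vec_def inner_axis intro!: has_derivative_inner_left assms)

lemma has_derivative_mat_entry:
  fixes F :: "complex \<Rightarrow> cmat2"
  assumes "(F has_derivative F') (at z)"
  shows "((\<lambda>w. F w $ i $ j) has_derivative (\<lambda>v. F' v $ i $ j)) (at z)"
  by (intro bounded_linear.has_derivative[OF bounded_linear_vec_nth] assms)

lemma has_derivative_holomorphic_mat:
  assumes "open D" "z \<in> D" "holomorphic_mat M D"
  shows "(M has_derivative (\<lambda>v. cscale v (mderiv M z))) (at z)"
  by (intro has_derivative_matI has_derivative_eq_rhs[OF
        has_field_derivative_imp_has_derivative[OF has_field_derivative_mderiv[OF assms]]])
     (simp add: fun_eq_iff entries)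

text \<open>The derivative splits into a complex-linear part, from the holomorphic factor, and a
  conjugate-linear part, from the antiholomorphic one.\<close>

lemma has_derivative_adjoint_mult:
  assumes D: "open D" "z \<in> D" and M: "holomorphic_mat M D" and N: "holomorphic_mat N D"
  shows "((\<lambda>w. adjoint_mat (M w) ** N w) has_derivative
    (\<lambda>v. cscale v (adjoint_mat (M z) ** mderiv N z) +
         cscale (cnj v) (adjoint_mat (mderiv M z) ** N z))) (at z)"
proof (rule has_derivative_matI)
  fix i j :: 2
  note M' = has_derivative_mat_entry[OF has_derivative_holomorphic_mat[OF D M]]
  note N' = has_derivative_mat_entry[OF has_derivative_holomorphic_mat[OF D N]]
  note cM' = bounded_linear.has_derivative[OF bounded_linear_cnj M']
  show "((\<lambda>w. (adjoint_mat (M w) ** N w) $ i $ j) has_derivative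
    (\<lambda>v. (cscale v (adjoint_mat (M z) ** mderiv N z) +
         cscale (cnj v) (adjoint_mat (mderiv M z) ** N z)) $ i $ j)) (at z)"
    unfolding entries vector_add_component
    by (rule has_derivative_eq_rhs)
       (auto simp: fun_eq_iff entries algebra_simps intro!: has_derivative_add has_derivative_mult cM' N')
qed

text \<open>\<open>P\<close> and \<open>R\<close> are the two Wirtinger derivatives of \<open>F\<close> at \<open>z\<close>.\<close>

definition has_wirtinger ::
    "(complex \<Rightarrow> cmat2) \<Rightarrow> cmat2 \<Rightarrow> cmat2 \<Rightarrow> complex \<Rightarrow> bool" where
  "has_wirtinger F P R z \<longleftrightarrow>
     (F has_derivative (\<lambda>v. cscale v P + cscale (cnj v) R)) (at z)"

lemma has_wirtinger_frechet:
  assumes "has_wirtinger F P R z"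
  shows "frechet_derivative F (at z) = (\<lambda>v. cscale v P + cscale (cnj v) R)"
  using frechet_derivative_at[OF assms[unfolded has_wirtinger_def]] by (rule sym)

lemma has_wirtinger_partials:
  assumes "has_wirtinger F P R z"
  shows "dx F z = P + R" "dy F z = cscale \<i> (P - R)" "dz F z = P" "dzbar F z = R"
  unfolding dz_def dzbar_def dx_def dy_def has_wirtinger_frechet[OF assms]
  by (simp_all add: mat2_eq_iff entries algebra_simps)

lemma has_derivative_cong_open:
  assumes "open D" "z \<in> D" "\<And>w. w \<in> D \<Longrightarrow> F w = G w"
  shows "(F has_derivative F') (at z) \<longleftrightarrow> (G has_derivative F') (at z)"
  using has_derivative_transform_within_open[OF _ assms(1,2), of F F' UNIV G]
    has_derivative_transform_within_open[OF _ assms(1,2), of G F' UNIV F] assms(3)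
  by metis

subsection \<open>Smoothness\<close>

lemma Ck_on_cong:
  assumes "open D" "\<And>z. z \<in> D \<Longrightarrow> F z = G z" "Ck_on k F D"
  shows "Ck_on k G D"
  using assms(2,3)
proof (induction k arbitrary: F G)
  case 0
  then show ?case
    using continuous_on_cong[of D D F G] by simp
next
  case (Suc k)
  have fd: "frechet_derivative F (at z) = frechet_derivative G (at z)" if "z \<in> D" for z
    using has_derivative_cong_open[where F = F and G = G, OF assms(1) that Suc.prems(1)]
    by (simp add: frechet_derivative_def)
  have "G differentiable (at z)" if "z \<in> D" for z
  proof -
    have "F differentiable (at z)"
      using Suc.prems(2) that by simp
    then show ?thesis
      using has_derivative_cong_open[where F = F and G = G, OF assms(1) that Suc.prems(1)]
      unfolding differentiable_def by blast
  qed
  moreover have "Ck_on k (dx G) D"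
  proof (rule Suc.IH)
    show "dx F z = dx G z" if "z \<in> D" for z
      using fd[OF that] by (simp add: dx_def)
  qed (use Suc.prems(2) in simp)
  moreover have "Ck_on k (dy G) D"
  proof (rule Suc.IH)
    show "dy F z = dy G z" if "z \<in> D" for z
      using fd[OF that] by (simp add: dy_def)
  qed (use Suc.prems(2) in simp)
  ultimately show ?case
    by simp
qed

lemma Ck_on_add:
  assumes "open D" "Ck_on k F D" "Ck_on k G D"
  shows "Ck_on k (\<lambda>z. F z + G z) D"
  using assms(2,3)
proof (induction k arbitrary: F G)
  case 0
  then show ?case
    by (auto intro: continuous_intros)
next
  case (Suc k)
  have fd: "frechet_derivative (\<lambda>w. F w + G w) (at z) =
      (\<lambda>v. frechet_derivative F (at z) v + frechet_derivative G (at z) v)" if "z \<in> D" for z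
  proof -
    have "F differentiable (at z)" "G differentiable (at z)"
      using Suc.prems that by simp_all
    then show ?thesis
      unfolding frechet_derivative_works
      by (rule frechet_derivative_at[symmetric, OF has_derivative_add])
  qed
  have "Ck_on k (dx (\<lambda>z. F z + G z)) D"
  proof (rule Ck_on_cong[OF assms(1) _ Suc.IH])
    show "dx F z + dx G z = dx (\<lambda>z. F z + G z) z" if "z \<in> D" for z
      using fd[OF that] by (simp add: dx_def)
  qed (use Suc.prems in simp_all)
  moreover have "Ck_on k (dy (\<lambda>z. F z + G z)) D"
  proof (rule Ck_on_cong[OF assms(1) _ Suc.IH])
    show "dy F z + dy G z = dy (\<lambda>z. F z + G z) z" if "z \<in> D" for z
      using fd[OF that] by (simp add: dy_def)
  qed (use Suc.prems in simp_all)
  ultimately show ?case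
    using Suc.prems by simp
qed

text \<open>Both partial derivatives of \<open>M* N\<close> are sums of two functions of the same kind, with \<open>M\<close>
  or \<open>N\<close> replaced by a constant multiple of its derivative, so induction on the order of
  differentiability applies.\<close>

lemma Ck_on_adjoint_mult:
  assumes "open D" "holomorphic_mat M D" "holomorphic_mat N D"
  shows "Ck_on k (\<lambda>z. adjoint_mat (M z) ** N z) D"
  using assms(2,3)
proof (induction k arbitrary: M N)
  case 0
  have "(\<lambda>z. adjoint_mat (M z) ** N z) differentiable at z" if "z \<in> D" for z
    using has_derivative_adjoint_mult[OF assms(1) that 0] unfolding differentiable_def by blast
  then show ?case
    by (simp add: continuous_at_imp_continuous_on differentiable_imp_continuous_within)
next
  case (Suc k)
  let ?F = "\<lambda>z. adjoint_mat (M z) ** N z"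
  have w: "has_wirtinger ?F (adjoint_mat (M z) ** mderiv N z)
      (adjoint_mat (mderiv M z) ** N z) z" if "z \<in> D" for z
    using has_derivative_adjoint_mult[OF assms(1) that Suc.prems] by (simp add: has_wirtinger_def)
  note M' = holomorphic_mat_mderiv[OF assms(1) Suc.prems(1)]
  note N' = holomorphic_mat_mderiv[OF assms(1) Suc.prems(2)]
  have "Ck_on k (dx ?F) D"
    by (rule Ck_on_cong[OF assms(1) _
          Ck_on_add[OF assms(1) Suc.IH[OF Suc.prems(1) N'] Suc.IH[OF M' Suc.prems(2)]]])
       (use has_wirtinger_partials(1)[OF w] in simp)
  moreover have "Ck_on k (dy ?F) D"
    by (rule Ck_on_cong[OF assms(1) _
          Ck_on_add[OF assms(1)
            Suc.IH[OF Suc.prems(1) holomorphic_mat_cscale[OF N', of \<i>]]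
            Suc.IH[OF M' holomorphic_mat_cscale[OF Suc.prems(2), of "-\<i>"]]]])
       (use has_wirtinger_partials(2)[OF w] in
          \<open>simp add: mult_cscale mat2_eq_iff entries algebra_simps\<close>)
  moreover have "?F differentiable at z" if "z \<in> D" for z
    using w[OF that] unfolding has_wirtinger_def differentiable_def by blast
  ultimately show ?case
    by simp
qed

section \<open>Orientation and the second fundamental form\<close>

text \<open>Orthogonality to the tangent vectors leaves only the commutator term of a positive basis.
  Transported back to \<open>p\<close>, the commutator becomes \<open>u p\<^sup>-\<^sup>1 v - v p\<^sup>-\<^sup>1 u\<close>, in which the
  transporting matrix \<open>V\<close> no longer occurs: an oriented normal lies on a ray that depends
  on \<open>p\<close>, \<open>u\<close> and \<open>v\<close> alone. This is what makes the unit normal well defined although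
  \<open>V\<close> is not unique.\<close>

lemma oriented_normal_parallel:
  assumes "positively_oriented p u v n" "form n u = 0" "form n v = 0"
  obtains c :: real where "c > 0"
    "n = c *\<^sub>R cscale (- (\<i>/2)) (u ** adjugate p ** v - v ** adjugate p ** u)"
proof -
  obtain V x y m where V: "det V = 1" and p: "p = V ** adjoint_mat V"
    and xym: "positive_at_one x y m"
    and u: "u = V ** x ** adjoint_mat V" and v: "v = V ** y ** adjoint_mat V"
    and n: "n = V ** m ** adjoint_mat V"
    using assms(1) unfolding positively_oriented_def by blast
  have form_V: "form (V ** s ** adjoint_mat V) (V ** t ** adjoint_mat V) = form s t" for s t
    using V by (simp add: form_mult_left form_mult_right det_adjoint)
  have herm: "hermitian x" "hermitian y" and tr: "trace x = 0" "trace y = 0"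
    using xym by (auto simp: positive_at_one_def)
  have indep: "a = 0 \<and> b = 0" if "a *\<^sub>R x + b *\<^sub>R y = 0" for a b :: real
    using xym that by (auto simp: positive_at_one_def)
  define w where "w = cscale (- (\<i>/2)) (x ** y - y ** x)"
  obtain a b c :: real where c: "c > 0" and m: "m = a *\<^sub>R x + b *\<^sub>R y + c *\<^sub>R w"
    using xym by (auto simp: positive_at_one_def w_def)
  define t where "t = a *\<^sub>R x + b *\<^sub>R y"
  have "form w x = 0" "form w y = 0"
    by (simp_all add: w_def form_entries entries tracefree_entry[OF tr(1)]
          tracefree_entry[OF tr(2)] algebra_simps)
  moreover have "form m x = 0" "form m y = 0"
    using assms(2,3) by (simp_all add: n u v form_V)
  ultimately have "form t x = 0" "form t y = 0"
    by (simp_all add: m t_def cscale_of_real[symmetric] form_bilinear)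
  then have "form t t = 0"
    by (subst (2) t_def) (simp add: cscale_of_real[symmetric] form_bilinear)
  moreover have "adjoint_mat t = t"
    using herm by (simp add: t_def hermitian_def cscale_of_real[symmetric] adjoint_add adjoint_cscale)
  moreover have "trace t = 0"
    by (simp add: t_def cscale_of_real[symmetric] entries tracefree_entry[OF tr(1)]
          tracefree_entry[OF tr(2)])
  \<comment> \<open>The form is positive definite on trace-free Hermitian matrices.\<close>
  ultimately have "t = 0"
    using form_adjoint_self[of t] by simp
  then have "m = c *\<^sub>R w"
    by (simp add: m t_def)
  then have n_eq: "n = c *\<^sub>R (V ** w ** adjoint_mat V)"
    by (simp add: n cscale_of_real[symmetric] mult_cscale)
  have w_eq: "V ** w ** adjoint_mat V =
      cscale (- (\<i>/2)) (V ** (x ** y) ** adjoint_mat V - V ** (y ** x) ** adjoint_mat V)"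
    by (simp add: w_def mult_cscale mult_distribs)
  have prod_eq: "V ** (s ** t) ** adjoint_mat V =
      V ** s ** adjoint_mat V ** adjugate p ** (V ** t ** adjoint_mat V)" for s t
  proof -
    have "V ** s ** adjoint_mat V ** adjugate p ** (V ** t ** adjoint_mat V) =
      V ** s ** (adjoint_mat V ** adjugate (adjoint_mat V)) ** (adjugate V ** V) ** t ** adjoint_mat V"
      by (simp add: p adjugate_mult matrix_mul_assoc)
    then show ?thesis
      using V by (simp add: adjugate_inverse det_adjoint matrix_mul_assoc)
  qed
  show ?thesis
    by (rule that[OF c]) (simp only: n_eq w_eq prod_eq u v)
qed

lemma unit_normal_eqI:
  assumes "hermitian n" "form n n = 1" "form n (F z) = 0"
    "form n (dx F z) = 0" "form n (dy F z) = 0"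
    "positively_oriented (F z) (dx F z) (dy F z) n"
  shows "unit_normal F z = n"
  unfolding unit_normal_def
proof (rule the_equality)
  fix n'
  assume n': "hermitian n' \<and> form n' n' = 1 \<and> form n' (F z) = 0 \<and>
     form n' (dx F z) = 0 \<and> form n' (dy F z) = 0 \<and>
     positively_oriented (F z) (dx F z) (dy F z) n'"
  define w where "w = cscale (- (\<i>/2))
    (dx F z ** adjugate (F z) ** dy F z - dy F z ** adjugate (F z) ** dx F z)"
  obtain c where c: "c > 0" "n = c *\<^sub>R w"
    using oriented_normal_parallel assms(4-6) unfolding w_def by blast
  obtain c' where c': "c' > 0" "n' = c' *\<^sub>R w"
    using oriented_normal_parallel n' unfolding w_def by blast
  have *: "of_real (c^2) * form w w = 1" "of_real (c'^2) * form w w = 1"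
    using assms(2) n' unfolding c(2) c'(2)
    by (simp_all add: cscale_of_real[symmetric] form_bilinear power2_eq_square mult.assoc)
  then have "form w w \<noteq> 0"
    by auto
  then have "complex_of_real (c^2) = of_real (c'^2)"
    using * by (metis mult_right_cancel)
  then have "c = c'"
    using c(1) c'(1) by (simp only: of_real_eq_iff) simp
  then show "n' = n"
    by (simp add: c c')
qed (use assms in auto)

text \<open>The quadratic forms \<open>v\<^sup>2\<close>, \<open>v cnj v\<close> and \<open>(cnj v)\<^sup>2\<close> are linearly independent; the
  arguments \<open>1\<close>, \<open>\<i>\<close> and \<open>1 + \<i>\<close> suffice to separate them.\<close>

lemma second_form_unique:
  assumes "second_form_eq F z Q H" "second_form_eq F z Q' H'" "metric_coeff F z \<noteq> 0"
  shows "Q = Q' \<and> H = H'"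
proof -
  have eq: "Q * v^2 + of_real H * (metric_coeff F z * of_real ((cmod v)^2)) + cnj Q * (cnj v)^2 =
      Q' * v^2 + of_real H' * (metric_coeff F z * of_real ((cmod v)^2)) + cnj Q' * (cnj v)^2" for v
    using assms(1,2) unfolding second_form_eq_def by metis
  let ?m = "metric_coeff F z"
  have e1: "Q + of_real H * ?m + cnj Q = Q' + of_real H' * ?m + cnj Q'"
    using eq[of 1] by simp
  have e2: "- Q + of_real H * ?m - cnj Q = - Q' + of_real H' * ?m - cnj Q'"
    using eq[of \<i>] by simp
  have "(1 + \<i>)^2 = 2 * \<i>" "(1 - \<i>)^2 = - (2 * \<i>)" "(cmod (1 + \<i>))^2 = 2"
    by (simp_all add: power2_eq_square algebra_simps cmod_def)
  then have e3: "Q * (2 * \<i>) + of_real H * (?m * 2) - cnj Q * (2 * \<i>) =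
      Q' * (2 * \<i>) + of_real H' * (?m * 2) - cnj Q' * (2 * \<i>)"
    using eq[of "1 + \<i>"] by simp
  have "2 * (of_real H * ?m) = 2 * (of_real H' * ?m)"
    using arg_cong2[OF e1 e2, of "(+)"] by (simp add: algebra_simps)
  then have H: "of_real H * ?m = of_real H' * ?m"
    by simp
  then have "H = H'"
    using assms(3) by simp
  moreover have "Q + cnj Q = Q' + cnj Q'" "Q - cnj Q = Q' - cnj Q'"
  proof -
    show "Q + cnj Q = Q' + cnj Q'"
      using e1 H by (simp add: add.assoc add.left_commute add.commute)
    have "(Q - cnj Q) * (2 * \<i>) = (Q' - cnj Q') * (2 * \<i>)"
      using e3 \<open>H = H'\<close> by (simp add: algebra_simps)
    then show "Q - cnj Q = Q' - cnj Q'"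
      by simp
  qed
  then have "((Q + cnj Q) + (Q - cnj Q)) / 2 = ((Q' + cnj Q') + (Q' - cnj Q')) / 2"
    by (simp only:)
  then have "Q = Q'"
    by simp
  ultimately show ?thesis
    by simp
qed

lemma
  assumes "second_form_eq F z Q H" "metric_coeff F z \<noteq> 0"
  shows hopf_coeff_eq: "hopf_coeff F z = Q" and mean_curvature_eq: "mean_curvature F z = H"
  unfolding hopf_coeff_def mean_curvature_def
  using assms second_form_unique by (blast intro: the_equality)+

section \<open>The surface of a null curve\<close>

text \<open>A holomorphic null curve in a coordinate, together with the surface \<open>F = \<Psi>* \<Psi>\<close>. Equality
  is required on \<open>D\<close> only, since a surface read in a chart is unspecified elsewhere.\<close>

locale null_curve_surface =
  fixes D :: "complex set" and \<Psi> F :: "complex \<Rightarrow> cmat2"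
  assumes open_D: "open D"
    and hol: "holomorphic_mat \<Psi> D"
    and det_\<Psi>: "z \<in> D \<Longrightarrow> det (\<Psi> z) = 1"
    and \<Psi>'_nonzero: "z \<in> D \<Longrightarrow> mderiv \<Psi> z \<noteq> 0"
    and det_\<Psi>': "z \<in> D \<Longrightarrow> det (mderiv \<Psi> z) = 0"
    and F_eq: "z \<in> D \<Longrightarrow> F z = adjoint_mat (\<Psi> z) ** \<Psi> z"
begin

abbreviation \<Psi>' where "\<Psi>' \<equiv> mderiv \<Psi>"
abbreviation \<Psi>'' where "\<Psi>'' \<equiv> mderiv \<Psi>'"

text \<open>The logarithmic derivative \<open>a = \<Psi>' \<Psi>\<^sup>-\<^sup>1\<close>. The isometry \<open>x \<mapsto> \<Psi>* x \<Psi>\<close> takes the identity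
  to the point of the surface and \<open>a\<close>, \<open>a*\<close> to the derivatives of \<open>F\<close> with respect to \<open>z\<close>
  and its conjugate, so the geometry of \<open>F\<close> to first order can be read off from \<open>a\<close>.\<close>

definition log_deriv :: "complex \<Rightarrow> cmat2" where
  "log_deriv z = \<Psi>' z ** adjugate (\<Psi> z)"

text \<open>Half of the conformal factor of the induced metric.\<close>

definition speed :: "complex \<Rightarrow> real" where
  "speed z = (norm (log_deriv z))\<^sup>2 / 2"

definition hopf :: "complex \<Rightarrow> complex" where
  "hopf z = - form (adjoint_mat (\<Psi> z) ** \<Psi>' z) (adjoint_mat (\<Psi>' z) ** \<Psi>'' z) / speed z"

lemma holomorphic_log_deriv: "holomorphic_mat log_deriv D"
  unfolding log_deriv_def
  by (intro holomorphic_mat_mult holomorphic_mat_mderiv holomorphic_mat_adjugate open_D hol)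

context
  fixes z assumes z: "z \<in> D"
begin

lemma \<Psi>'_eq: "\<Psi>' z = log_deriv z ** \<Psi> z"
  using adjugate_inverse(1)[OF det_\<Psi>[OF z]]
  by (simp add: log_deriv_def matrix_mul_assoc[symmetric])

lemma log_deriv_nonzero: "log_deriv z \<noteq> 0"
  using \<Psi>'_eq \<Psi>'_nonzero[OF z] by auto

lemma det_log_deriv: "det (log_deriv z) = 0"
  using det_\<Psi>'[OF z] by (simp add: log_deriv_def det_mul)

text \<open>The trace is the derivative of \<open>det \<Psi>\<close>, which is constant.\<close>

lemma trace_log_deriv: "trace (log_deriv z) = 0"
proof -
  have "((\<lambda>w. det (\<Psi> w)) has_field_derivative trace (log_deriv z)) (at z)"
    unfolding det_2 log_deriv_def using has_field_derivative_mderiv[OF open_D z hol]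
    by (auto simp: entries algebra_simps intro!: derivative_eq_intros)
  moreover have "((\<lambda>w. det (\<Psi> w)) has_field_derivative 0) (at z)"
    using has_field_derivative_transform_within_open[OF DERIV_const open_D z] det_\<Psi> by metis
  ultimately show ?thesis
    by (rule DERIV_unique)
qed

lemma speed_pos: "speed z > 0"
  using log_deriv_nonzero by (simp add: speed_def)

lemma form_log_deriv: "form (log_deriv z) (adjoint_mat (log_deriv z)) = speed z"
  using form_adjoint_self[OF trace_log_deriv] by (simp add: speed_def)

lemma form_transport:
  "form (adjoint_mat (\<Psi> z) ** x ** \<Psi> z) (adjoint_mat (\<Psi> z) ** y ** \<Psi> z) = form x y"
  using det_\<Psi>[OF z] by (simp add: form_mult_left form_mult_right det_adjoint)

lemma F_transport: "F z = adjoint_mat (\<Psi> z) ** mat 1 ** \<Psi> z"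
  using F_eq[OF z] by simp

lemma F_z_transport: "adjoint_mat (\<Psi> z) ** \<Psi>' z = adjoint_mat (\<Psi> z) ** log_deriv z ** \<Psi> z"
  by (simp add: \<Psi>'_eq matrix_mul_assoc)

lemma F_zbar_transport:
  "adjoint_mat (\<Psi>' z) ** \<Psi> z = adjoint_mat (\<Psi> z) ** adjoint_mat (log_deriv z) ** \<Psi> z"
  by (simp add: \<Psi>'_eq adjoint_mult)

lemma wirtinger_F:
  "has_wirtinger F (adjoint_mat (\<Psi> z) ** \<Psi>' z) (adjoint_mat (\<Psi>' z) ** \<Psi> z) z"
  using has_derivative_adjoint_mult[OF open_D z hol hol] F_eq
    has_derivative_cong_open[OF open_D z, of F "\<lambda>w. adjoint_mat (\<Psi> w) ** \<Psi> w"]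
  by (simp add: has_wirtinger_def)

lemma form_partials:
  "form (adjoint_mat (\<Psi> z) ** \<Psi>' z) (adjoint_mat (\<Psi>' z) ** \<Psi> z) = speed z"
  "form (adjoint_mat (\<Psi> z) ** \<Psi>' z) (adjoint_mat (\<Psi> z) ** \<Psi>' z) = 0"
  "form (adjoint_mat (\<Psi>' z) ** \<Psi> z) (adjoint_mat (\<Psi>' z) ** \<Psi> z) = 0"
  unfolding F_z_transport F_zbar_transport form_transport
  using form_log_deriv det_log_deriv by (simp_all add: form_self det_adjoint)

lemma metric_coeff_F: "metric_coeff F z = 2 * speed z"
  unfolding metric_coeff_def has_wirtinger_partials[OF wirtinger_F] form_partials by simp

lemma conformal_at:
  "form (dx F z) (dx F z) = form (dy F z) (dy F z) \<and> form (dx F z) (dy F z) = 0"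
  unfolding has_wirtinger_partials[OF wirtinger_F]
  using form_partials form_commute[of "adjoint_mat (\<Psi>' z) ** \<Psi> z" "adjoint_mat (\<Psi> z) ** \<Psi>' z"]
  by (simp add: form_bilinear algebra_simps)

lemma inj_derivative: "inj (frechet_derivative F (at z))"
proof (rule injI)
  fix v w
  assume eq: "frechet_derivative F (at z) v = frechet_derivative F (at z) w"
  have "form (frechet_derivative F (at z) u) (adjoint_mat (\<Psi>' z) ** \<Psi> z) = u * speed z" for u
    unfolding has_wirtinger_frechet[OF wirtinger_F] by (simp add: form_bilinear form_partials)
  then have "v * speed z = w * speed z"
    using eq by metis
  then show "v = w"
    using speed_pos by simp
qed

text \<open>The unit normal transported to the identity. As \<open>a\<close> has rank one,
  \<open>a* a / speed\<close> is twice the orthogonal projection onto the orthogonal complement of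
  the kernel of \<open>a\<close>, so this is a reflection.\<close>

definition normal_at_one :: cmat2 where
  "normal_at_one = cscale (1 / speed z) (adjoint_mat (log_deriv z) ** log_deriv z) - mat 1"

text \<open>With \<open>x = a + a*\<close> and \<open>y = \<i> (a - a*)\<close>, which are transported to the two real partial
  derivatives of \<open>F\<close>, one has \<open>-(\<i>/2) [x, y] = a* a - a a*\<close>. As the sum of \<open>a* a\<close> and \<open>a a*\<close>
  is \<open>2 speed\<close> times the identity, this is \<open>2 speed\<close> times the proposed normal.\<close>

lemma positive_frame:
  fixes a defines "a \<equiv> log_deriv z"
  shows "positive_at_one (a + adjoint_mat a) (cscale \<i> (a - adjoint_mat a)) normal_at_one"
  unfolding positive_at_one_def
proof (intro conjI)
  have a22: "a$2$2 = - a$1$1"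
    using trace_log_deriv tracefree_entry by (simp add: a_def)
  have s: "speed z \<noteq> 0"
    using speed_pos by simp
  have tr: "trace (adjoint_mat a ** a) = 2 * speed z"
    using trace_adjoint_mult_self[of a] by (simp add: speed_def a_def)
  have "hermitian (a + adjoint_mat a)" "hermitian (cscale \<i> (a - adjoint_mat a))"
    by (simp_all add: hermitian_def mat2_eq_iff entries algebra_simps)
  moreover have "hermitian normal_at_one"
    by (simp add: hermitian_def normal_at_one_def mat2_eq_iff entries)
  moreover have "trace (a + adjoint_mat a) = 0" "trace (cscale \<i> (a - adjoint_mat a)) = 0"
    by (simp_all add: entries a22 algebra_simps)
  moreover have "trace normal_at_one = trace (adjoint_mat a ** a) / speed z - 2"
    unfolding normal_at_one_def a_def by (simp add: entries add_divide_distrib algebra_simps)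
  then have "trace normal_at_one = 0"
    using s by (simp add: tr)
  ultimately show "\<forall>v\<in>{a + adjoint_mat a, cscale \<i> (a - adjoint_mat a), normal_at_one}.
      hermitian v \<and> trace v = 0"
    by simp
  show "\<forall>\<alpha> \<beta> :: real. \<alpha> *\<^sub>R (a + adjoint_mat a) + \<beta> *\<^sub>R cscale \<i> (a - adjoint_mat a) = 0 \<longrightarrow>
      \<alpha> = 0 \<and> \<beta> = 0"
  proof (intro allI impI)
    fix \<alpha> \<beta> :: real
    let ?t = "\<alpha> *\<^sub>R (a + adjoint_mat a) + \<beta> *\<^sub>R cscale \<i> (a - adjoint_mat a)"
    assume "?t = 0"
    then have "form a ?t = 0"
      by simp
    moreover have "form a ?t = (\<alpha> - \<i> * \<beta>) * speed z"
      unfolding cscale_of_real[symmetric]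
      using form_log_deriv det_log_deriv
      by (simp add: form_bilinear form_self a_def[symmetric] algebra_simps)
    ultimately have "complex_of_real \<alpha> - \<i> * \<beta> = 0"
      using s by simp
    then show "\<alpha> = 0 \<and> \<beta> = 0"
      by (simp add: complex_eq_iff)
  qed
  have anti: "a ** adjoint_mat a = cscale (2 * speed z) (mat 1) - adjoint_mat a ** a"
    using form_log_deriv tracefree_anticommutator[OF trace_log_deriv]
    by (simp add: a_def[symmetric] algebra_simps)
  have n_eq: "normal_at_one = cscale (1 / speed z) (adjoint_mat a ** a) - mat 1"
    by (simp add: normal_at_one_def a_def)
  have "normal_at_one = 0 *\<^sub>R (a + adjoint_mat a) + 0 *\<^sub>R cscale \<i> (a - adjoint_mat a) +
      (1 / (2 * speed z)) *\<^sub>R cscale (- (\<i>/2))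
        ((a + adjoint_mat a) ** cscale \<i> (a - adjoint_mat a) -
         cscale \<i> (a - adjoint_mat a) ** (a + adjoint_mat a))"
  proof -
    have "cscale (- (\<i>/2)) ((a + adjoint_mat a) ** cscale \<i> (a - adjoint_mat a) -
         cscale \<i> (a - adjoint_mat a) ** (a + adjoint_mat a)) =
        adjoint_mat a ** a - a ** adjoint_mat a"
      by (simp add: mat2_eq_iff entries field_simps)
    also have "\<dots> = cscale (2 * speed z) normal_at_one"
      using s unfolding anti n_eq
      by (simp add: mat2_eq_iff entries field_simps)
    finally show ?thesis
      using s by (simp add: cscale_of_real[symmetric])
  qed
  then show "\<exists>\<alpha> \<beta> c :: real. c > 0 \<and> normal_at_one =
      \<alpha> *\<^sub>R (a + adjoint_mat a) + \<beta> *\<^sub>R cscale \<i> (a - adjoint_mat a) +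
      c *\<^sub>R cscale (- (\<i>/2)) ((a + adjoint_mat a) ** cscale \<i> (a - adjoint_mat a) -
         cscale \<i> (a - adjoint_mat a) ** (a + adjoint_mat a))"
    using speed_pos by (intro exI[of _ 0] exI[of _ "1 / (2 * speed z)"]) auto
qed

text \<open>Adding \<open>F\<close> to the normal gives a multiple of \<open>\<Psi>'* \<Psi>'\<close>, a matrix of rank one. It lies on
  the light cone and represents the hyperbolic Gauss map.\<close>

lemma unit_normal_F:
  "unit_normal F z = (1 / speed z) *\<^sub>R (adjoint_mat (\<Psi>' z) ** \<Psi>' z) - F z"
proof -
  let ?a = "log_deriv z" and ?V = "adjoint_mat (\<Psi> z)"
  let ?n = "?V ** normal_at_one ** \<Psi> z"
  have s: "complex_of_real (speed z) \<noteq> 0"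
    using speed_pos by simp
  have F_x: "dx F z = ?V ** (?a + adjoint_mat ?a) ** \<Psi> z"
    and F_y: "dy F z = ?V ** cscale \<i> (?a - adjoint_mat ?a) ** \<Psi> z"
    unfolding has_wirtinger_partials[OF wirtinger_F] F_z_transport F_zbar_transport
    by (simp_all add: mult_distribs mult_cscale)
  have "form (adjoint_mat ?a ** ?a) (mat 1) = - speed z"
    using trace_adjoint_mult_self[of ?a] by (simp add: form_one speed_def)
  moreover have "form (adjoint_mat ?a ** ?a) (adjoint_mat ?a ** ?a) = 0"
    using det_log_deriv by (simp add: form_self det_mul)
  moreover have "form (mat 1) (mat 1) = - 1"
    by (simp add: form_self entries)
  ultimately have nn: "form normal_at_one normal_at_one = 1" and n1: "form normal_at_one (mat 1) = 0"
    using s form_commute[of "mat 1" "adjoint_mat ?a ** ?a"]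
    by (simp_all add: normal_at_one_def form_bilinear)
  have "form (adjoint_mat ?a ** ?a) (mat 1 ** ?a) = 0"
    using det_log_deriv unfolding form_mult_right by simp
  moreover have "form (adjoint_mat ?a ** ?a) (adjoint_mat ?a ** mat 1) = 0"
    using det_log_deriv unfolding form_mult_left by (simp add: det_adjoint)
  moreover have "form (mat 1) ?a = 0" "form (mat 1) (adjoint_mat ?a) = 0"
    using form_one trace_log_deriv trace_adjoint[of ?a] by (simp_all add: form_commute[of "mat 1"])
  ultimately have na: "form normal_at_one ?a = 0" "form normal_at_one (adjoint_mat ?a) = 0"
    by (simp_all add: normal_at_one_def form_bilinear)
  have pos: "positively_oriented (F z) (dx F z) (dy F z) ?n"
    unfolding positively_oriented_def
    using positive_frame det_\<Psi>[OF z]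
    by (intro exI[of _ ?V] exI[of _ "?a + adjoint_mat ?a"]
          exI[of _ "cscale \<i> (?a - adjoint_mat ?a)"] exI[of _ normal_at_one])
       (simp add: F_x F_y F_eq[OF z] det_adjoint)
  have "hermitian normal_at_one"
    using positive_frame by (simp add: positive_at_one_def)
  then have "hermitian ?n"
    by (simp add: hermitian_def adjoint_mult matrix_mul_assoc)
  moreover have "form ?n ?n = 1" "form ?n (F z) = 0" "form ?n (dx F z) = 0" "form ?n (dy F z) = 0"
    unfolding F_x F_y F_transport form_transport by (simp_all add: nn n1 na form_bilinear)
  ultimately have "unit_normal F z = ?n"
    using pos by (intro unit_normal_eqI)
  then show ?thesis
    by (simp add: normal_at_one_def F_eq[OF z] mult_distribs mult_cscale \<Psi>'_eq adjoint_mult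
        cscale_of_real[symmetric] matrix_mul_assoc)
qed

end

lemma wirtinger_normal_part:
  assumes "z \<in> D"
  shows "has_wirtinger (\<lambda>w. adjoint_mat (\<Psi>' w) ** \<Psi>' w)
    (adjoint_mat (\<Psi>' z) ** \<Psi>'' z) (adjoint_mat (\<Psi>'' z) ** \<Psi>' z) z"
  using holomorphic_mat_mderiv[OF open_D hol] unfolding has_wirtinger_def
  by (intro has_derivative_adjoint_mult[OF open_D assms])

lemma speed_differentiable:
  assumes "z \<in> D"
  shows "(\<lambda>w. 1 / speed w) differentiable (at z)"
proof -
  have "log_deriv differentiable (at z)"
    using has_derivative_holomorphic_mat[OF open_D assms holomorphic_log_deriv]
    unfolding differentiable_def by blast
  then have "(\<lambda>w. 1 / ((log_deriv w \<bullet> log_deriv w) / 2)) differentiable (at z)"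
    using log_deriv_nonzero[OF assms]
    by (intro differentiable_divide differentiable_inner differentiable_const) auto
  then show ?thesis
    by (simp add: speed_def power2_norm_eq_inner)
qed

text \<open>Write the normal as \<open>E / speed - F\<close> with \<open>E = \<Psi>'* \<Psi>'\<close>. The summand \<open>- F\<close> contributes
  exactly the metric to \<open>- <dF, dN>\<close>, so the mean curvature is 1 as soon as \<open>E / speed\<close>
  has no mixed term. The derivative of the factor \<open>1 / speed\<close> drops out because \<open>dF\<close> is
  orthogonal to \<open>E\<close>, and the mixed terms drop out because in each of them both arguments
  have the singular factor \<open>\<Psi>'\<close> or its adjoint in common.\<close>

lemma
  assumes z: "z \<in> D"
  shows unit_normal_differentiable: "unit_normal F differentiable (at z)"
    and second_form_F: "second_form_eq F z (hopf z) 1"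
proof -
  let ?P = "adjoint_mat (\<Psi> z) ** \<Psi>' z" and ?R = "adjoint_mat (\<Psi>' z) ** \<Psi> z"
  let ?E = "\<lambda>w. adjoint_mat (\<Psi>' w) ** \<Psi>' w"
  let ?E' = "\<lambda>v. cscale v (adjoint_mat (\<Psi>' z) ** \<Psi>'' z) +
    cscale (cnj v) (adjoint_mat (\<Psi>'' z) ** \<Psi>' z)"
  let ?F' = "\<lambda>v. cscale v ?P + cscale (cnj v) ?R"
  obtain r' where r': "((\<lambda>w. 1 / speed w) has_derivative r') (at z)"
    using speed_differentiable[OF z] unfolding differentiable_def by blast
  have "((\<lambda>w. (1 / speed w) *\<^sub>R ?E w - F w) has_derivative
      (\<lambda>v. (1 / speed z) *\<^sub>R ?E' v + r' v *\<^sub>R ?E z - ?F' v)) (at z)"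
    using wirtinger_normal_part[OF z] wirtinger_F[OF z] unfolding has_wirtinger_def
    by (intro has_derivative_diff has_derivative_scaleR r')
  then have N': "(unit_normal F has_derivative
      (\<lambda>v. (1 / speed z) *\<^sub>R ?E' v + r' v *\<^sub>R ?E z - ?F' v)) (at z)"
    by (rule has_derivative_transform_within_open[OF _ open_D z]) (simp add: unit_normal_F)
  then show "unit_normal F differentiable (at z)"
    unfolding differentiable_def by blast
  have s: "complex_of_real (speed z) \<noteq> 0"
    using speed_pos[OF z] by simp
  have det0: "det (\<Psi>' z) = 0" "det (adjoint_mat (\<Psi>' z)) = 0"
    using det_\<Psi>'[OF z] by (simp_all add: det_adjoint)
  have vanish: "form ?P (?E z) = 0" "form ?R (?E z) = 0"
    "form ?P (adjoint_mat (\<Psi>'' z) ** \<Psi>' z) = 0" "form ?R (adjoint_mat (\<Psi>' z) ** \<Psi>'' z) = 0"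
    unfolding form_mult_left form_mult_right using det0 by simp_all
  let ?q = "form ?P (adjoint_mat (\<Psi>' z) ** \<Psi>'' z)"
  have conj: "form ?R (adjoint_mat (\<Psi>'' z) ** \<Psi>' z) = cnj ?q"
    by (simp add: form_adjoint[symmetric] adjoint_mult)
  have metric: "form (?F' v) (?F' v) = 2 * speed z * (v * cnj v)" for v
    using form_partials[OF z] form_commute[of ?R ?P] by (simp add: form_bilinear algebra_simps)
  have expand: "form X (p *\<^sub>R Y + q *\<^sub>R Z - W) =
      of_real p * form X Y + of_real q * form X Z - form X W"
    for p q :: real and X Y Z W
    by (simp add: cscale_of_real[symmetric] form_bilinear)
  show "second_form_eq F z (hopf z) 1"
    unfolding second_form_eq_def frechet_derivative_at[OF N', symmetric]
      has_wirtinger_frechet[OF wirtinger_F[OF z]] metric_coeff_F[OF z]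
  proof
    fix v
    have "form (?F' v) (?E' v) = v^2 * ?q + (cnj v)^2 * cnj ?q"
      using vanish conj by (simp add: form_bilinear power2_eq_square algebra_simps)
    moreover have "form (?F' v) (?E z) = 0"
      using vanish by (simp add: form_bilinear)
    ultimately have eq: "form (?F' v) ((1 / speed z) *\<^sub>R ?E' v + r' v *\<^sub>R ?E z - ?F' v) =
        of_real (1 / speed z) * (v^2 * ?q + (cnj v)^2 * cnj ?q) + of_real (r' v) * 0 -
        2 * speed z * (v * cnj v)"
      by (simp only: expand metric)
    show "- form (?F' v) ((1 / speed z) *\<^sub>R ?E' v + r' v *\<^sub>R ?E z - ?F' v) =
      hopf z * v^2 + of_real 1 * (complex_of_real (2 * speed z) * of_real ((cmod v)\<^sup>2)) + cnj (hopf z) * (cnj v)\<^sup>2"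
      unfolding eq complex_norm_square using s by (simp add: hopf_def field_simps)
  qed
qed

lemma hopf_coeff_F:
  assumes "z \<in> D"
  shows "hopf_coeff F z = hopf z"
  using hopf_coeff_eq second_form_F[OF assms] metric_coeff_F[OF assms] speed_pos[OF assms] by simp

lemma mean_curvature_F:
  assumes "z \<in> D"
  shows "mean_curvature F z = 1"
  using mean_curvature_eq second_form_F[OF assms] metric_coeff_F[OF assms] speed_pos[OF assms]
  by simp

text \<open>From \<open>\<Psi>' = a \<Psi>\<close> and \<open>a\<^sup>2 = 0\<close> follows \<open>\<Psi>'' = a' \<Psi>\<close>, so the Hopf differential is
  determined by \<open>a\<close> and its derivative.\<close>

lemma hopf_log_deriv:
  assumes z: "z \<in> D"
  shows "hopf z = - form (log_deriv z) (adjoint_mat (log_deriv z) ** mderiv log_deriv z) / speed z"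
proof -
  have "\<Psi>'' z = mderiv (\<lambda>w. log_deriv w ** \<Psi> w) z"
    using \<Psi>'_eq by (rule mderiv_cong[OF open_D z])
  also have "\<dots> = mderiv log_deriv z ** \<Psi> z + log_deriv z ** (log_deriv z ** \<Psi> z)"
    using mderiv_mult[OF open_D z holomorphic_log_deriv hol] \<Psi>'_eq[OF z] by simp
  also have "log_deriv z ** (log_deriv z ** \<Psi> z) = 0"
    using square_zero_2[OF trace_log_deriv[OF z] det_log_deriv[OF z]] by (simp add: matrix_mul_assoc)
  finally have "adjoint_mat (\<Psi>' z) ** \<Psi>'' z =
      adjoint_mat (\<Psi> z) ** (adjoint_mat (log_deriv z) ** mderiv log_deriv z) ** \<Psi> z"
    by (simp add: \<Psi>'_eq[OF z] adjoint_mult matrix_mul_assoc)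
  then show ?thesis
    unfolding hopf_def F_z_transport[OF z] by (simp add: form_transport[OF z])
qed

lemma immersion_on_F: "immersion_on F D"
  unfolding immersion_on_def
  using Ck_on_cong[OF open_D _ Ck_on_adjoint_mult[OF open_D hol hol]] F_eq inj_derivative by simp

lemma conformal_on_F: "conformal_on F D"
  unfolding conformal_on_def using conformal_at by blast

end

text \<open>The conformal factor \<open>2 <a, a*>\<close> is homogeneous of bidegree \<open>(1,1)\<close> in \<open>a\<close>, and the Hopf
  differential \<open>- <a, a* a'> / <a, a*>\<close> is a quotient of bidegrees \<open>(2,1)\<close> and \<open>(1,1)\<close>.\<close>

lemma complex_scaling:
  assumes "null_curve_surface D \<Psi> F" "null_curve_surface D \<Psi>1 F1" and z: "z \<in> D"
    and log_deriv: "\<And>w. w \<in> D \<Longrightarrow> null_curve_surface.log_deriv \<Psi>1 w =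
      cscale \<mu> (null_curve_surface.log_deriv \<Psi> w)"
  shows "metric_coeff F1 z = of_real ((cmod \<mu>)\<^sup>2) * metric_coeff F z"
    and "hopf_coeff F1 z = \<mu> * hopf_coeff F z"
proof -
  interpret S: null_curve_surface D \<Psi> F by fact
  interpret S1: null_curve_surface D \<Psi>1 F1 by fact
  let ?a = "S.log_deriv z"
  have speed: "complex_of_real (S1.speed z) = \<mu> * cnj \<mu> * S.speed z"
    unfolding S1.form_log_deriv[OF z, symmetric] S.form_log_deriv[OF z, symmetric]
    by (simp add: log_deriv[OF z] adjoint_cscale form_bilinear)
  then show "metric_coeff F1 z = of_real ((cmod \<mu>)\<^sup>2) * metric_coeff F z"
    unfolding S.metric_coeff_F[OF z] S1.metric_coeff_F[OF z] complex_norm_square by simp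
  have "\<mu> \<noteq> 0"
    using S1.log_deriv_nonzero[OF z] by (auto simp: log_deriv[OF z])
  have "mderiv S1.log_deriv z = mderiv (\<lambda>w. cscale \<mu> (S.log_deriv w)) z"
    using log_deriv by (rule mderiv_cong[OF S.open_D z])
  also have "\<dots> = cscale \<mu> (mderiv S.log_deriv z)"
    using has_field_derivative_mderiv[OF S.open_D z S.holomorphic_log_deriv]
    by (intro mderiv_eqI) (auto simp: entries intro!: derivative_eq_intros)
  finally have "S1.hopf z = - (\<mu> * (cnj \<mu> * (\<mu> *
      form ?a (adjoint_mat ?a ** mderiv S.log_deriv z)))) / (\<mu> * cnj \<mu> * S.speed z)"
    unfolding S1.hopf_log_deriv[OF z] speed
    by (simp add: log_deriv[OF z] adjoint_cscale mult_cscale form_bilinear mult_ac)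
  also have "\<dots> = \<mu> * S.hopf z"
    using \<open>\<mu> \<noteq> 0\<close> S.speed_pos[OF z] unfolding S.hopf_log_deriv[OF z] by (simp add: field_simps)
  finally show "hopf_coeff F1 z = \<mu> * hopf_coeff F z"
    using S.hopf_coeff_F[OF z] S1.hopf_coeff_F[OF z] by simp
qed

section \<open>Null curves on a Riemann surface\<close>

lemma in_chart_apply: "in_chart c g z = g (the_inv_into (fst c) (snd c) z)"
  by (simp add: in_chart_def)

lemma
  assumes "riemann_surface X \<A>" "c \<in> \<A>"
  shows open_chart_image: "open (chart_image c)"
    and chart_point: "z \<in> chart_image c \<Longrightarrow> the_inv_into (fst c) (snd c) z \<in> topspace X"
proof -
  have c: "openin X (fst c)" "open (chart_image c)"
    "homeomorphic_map (subtopology X (fst c)) (top_of_set (chart_image c)) (snd c)"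
    using assms by (auto simp: riemann_surface_def)
  show "open (chart_image c)"
    by fact
  have "fst c \<subseteq> topspace X"
    using c(1) openin_subset by blast
  then have "inj_on (snd c) (fst c)"
    using homeomorphic_imp_injective_map[OF c(3)] by (simp add: Int_absorb1)
  then show "the_inv_into (fst c) (snd c) z \<in> topspace X" if "z \<in> chart_image c"
    using that the_inv_into_into[of "snd c" "fst c" z "fst c"] \<open>fst c \<subseteq> topspace X\<close>
    unfolding chart_image_def by blast
qed

lemma null_curve_surface_in_chart:
  assumes "riemann_surface X \<A>" "null_curve X \<A> \<Psi>" "c \<in> \<A>"
    and "\<And>p. p \<in> topspace X \<Longrightarrow> f p = adjoint_mat (\<Psi> p) ** \<Psi> p"
  shows "null_curve_surface (chart_image c) (in_chart c \<Psi>) (in_chart c f)"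
proof
  show "open (chart_image c)"
    using open_chart_image assms by blast
  show "holomorphic_mat (in_chart c \<Psi>) (chart_image c)"
    using assms(2,3) by (auto simp: null_curve_def holomorphic_mat_def)
  fix z assume z: "z \<in> chart_image c"
  show "mderiv (in_chart c \<Psi>) z \<noteq> 0" "det (mderiv (in_chart c \<Psi>) z) = 0"
    using assms(2,3) z by (auto simp: null_curve_def)
  show "det (in_chart c \<Psi> z) = 1"
    "in_chart c f z = adjoint_mat (in_chart c \<Psi> z) ** in_chart c \<Psi> z"
    using assms(2,4) chart_point[OF assms(1,3) z] by (auto simp: null_curve_def in_chart_apply)
qed

theorem null_curve_cmc1_immersion:
  assumes "riemann_surface X \<A>" "null_curve X \<A> \<Psi>"
    and f: "\<And>p. p \<in> topspace X \<Longrightarrow> f p = adjoint_mat (\<Psi> p) ** \<Psi> p"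
  shows "cmc1_immersion X \<A> f"
proof -
  note S = null_curve_surface_in_chart[OF assms(1,2) _ f]
  have "f ` topspace X \<subseteq> H3"
    using assms(2) by (auto simp: f null_curve_def intro: H3_adjoint_mult)
  moreover have "immersion_on (in_chart c f) (chart_image c)"
    "conformal_on (in_chart c f) (chart_image c)" if "c \<in> \<A>" for c
    using null_curve_surface.immersion_on_F[OF S[OF that]]
      null_curve_surface.conformal_on_F[OF S[OF that]] by auto
  moreover have "unit_normal (in_chart c f) differentiable (at z)"
    "\<exists>Q. second_form_eq (in_chart c f) z Q 1" "mean_curvature (in_chart c f) z = 1"
    if "c \<in> \<A>" "z \<in> chart_image c" for c z
    using null_curve_surface.unit_normal_differentiable[OF S[OF that(1)] that(2)]
      null_curve_surface.second_form_F[OF S[OF that(1)] that(2)]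
      null_curve_surface.mean_curvature_F[OF S[OF that(1)] that(2)] by auto
  ultimately show ?thesis
    by (simp add: cmc1_immersion_def immersion_def)
qed

section \<open>LWR frames\<close>

locale lwr_frame_on =
  fixes D :: "complex set" and \<Phi> :: "complex \<Rightarrow> complex \<Rightarrow> cmat2"
  assumes open_D: "open D"
    and hol: "holomorphic_mat (\<Phi> l) D"
    and det_\<Phi>: "z \<in> D \<Longrightarrow> det (\<Phi> l z) = 1"
    and potential: "lwr_potential_on D (\<lambda>l z. matrix_inv (\<Phi> l z) ** mderiv (\<Phi> l) z)"
begin

definition \<xi> :: "complex \<Rightarrow> complex \<Rightarrow> cmat2" where
  "\<xi> l z = matrix_inv (\<Phi> l z) ** mderiv (\<Phi> l) z"

text \<open>The nilpotent coefficient \<open>A\<close> of the potential \<open>A \<lambda> + B\<close>, obtained globally from two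
  values of the potential.\<close>

definition leading :: "complex \<Rightarrow> cmat2" where
  "leading z = \<xi> 1 z - \<xi> 0 z"

text \<open>As the frame itself is holomorphic, its potential has no poles.\<close>

lemma holomorphic_\<xi>: "holomorphic_mat (\<xi> l) D"
proof -
  have "holomorphic_mat (\<lambda>z. adjugate (\<Phi> l z) ** mderiv (\<Phi> l) z) D"
    by (intro holomorphic_mat_mult holomorphic_mat_adjugate holomorphic_mat_mderiv open_D hol)
  then show ?thesis
    by (subst holomorphic_mat_cong) (auto simp: \<xi>_def matrix_inv_eq_adjugate det_\<Phi>)
qed

lemma
  assumes z: "z \<in> D"
  shows \<xi>_affine: "\<xi> l z = cscale l (leading z) + \<xi> 0 z"
    and trace_\<xi>: "trace (\<xi> l z) = 0"
    and det_leading: "det (leading z) = 0"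
proof -
  define P where "P = {z\<in>D. \<exists>l i j. \<not> (\<lambda>z. \<xi> l z $ i $ j) analytic_on {z}}"
  have local_form: "\<forall>z0\<in>D - P. \<exists>U A B. open U \<and> z0 \<in> U \<and> U \<subseteq> D \<and>
      (\<forall>i j. (\<lambda>z. A z $ i $ j) holomorphic_on U \<and> (\<lambda>z. B z $ i $ j) holomorphic_on U) \<and>
      (\<forall>z\<in>U. nilpotent_mat (A z) \<and>
         (\<forall>l. trace (\<xi> l z) = 0 \<and> \<xi> l z = cscale l (A z) + B z))"
    using potential unfolding lwr_potential_on_def Let_def P_def \<xi>_def by blast
  have "(\<lambda>z. \<xi> l z $ i $ j) analytic_on D" for l i j
    using holomorphic_\<xi>[of l] open_D by (simp add: holomorphic_mat_def analytic_on_open)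
  then have "(\<lambda>z. \<xi> l z $ i $ j) analytic_on {w}" if "w \<in> D" for l i j w
    using analytic_on_subset that by blast
  then have "P = {}"
    by (auto simp: P_def)
  then obtain A B where A: "nilpotent_mat (A z)"
    and \<xi>: "\<And>l. trace (\<xi> l z) = 0 \<and> \<xi> l z = cscale l (A z) + B z"
    using local_form z by (metis Diff_empty)
  have "leading z = A z" "\<xi> 0 z = B z"
    using \<xi>[of 0] \<xi>[of 1] by (simp_all add: leading_def)
  then show "\<xi> l z = cscale l (leading z) + \<xi> 0 z" "trace (\<xi> l z) = 0" "det (leading z) = 0"
    using \<xi>[of l] nilpotent_mat_det[OF A] by metis+
qed

definition curve :: "complex \<Rightarrow> complex \<Rightarrow> complex \<Rightarrow> cmat2" where
  "curve s t z = \<Phi> t z ** adjugate (\<Phi> s z)"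

lemma holomorphic_curve: "holomorphic_mat (curve s t) D"
  unfolding curve_def by (intro holomorphic_mat_mult holomorphic_mat_adjugate hol)

text \<open>The coefficient \<open>B\<close> of the potential cancels in \<open>\<xi> t - \<xi> s\<close>, which leaves a multiple of
  the nilpotent coefficient.\<close>

lemma mderiv_curve:
  assumes z: "z \<in> D"
  shows "mderiv (curve s t) z = cscale (t - s) (\<Phi> t z ** leading z ** adjugate (\<Phi> s z))"
proof -
  have d\<Phi>: "mderiv (\<Phi> l) z = \<Phi> l z ** \<xi> l z" for l
    using adjugate_inverse(2)[OF det_\<Phi>[OF z]]
    by (simp add: \<xi>_def matrix_inv_eq_adjugate det_\<Phi>[OF z] matrix_mul_assoc)
  have "mderiv (curve s t) z =
      mderiv (\<Phi> t) z ** adjugate (\<Phi> s z) + \<Phi> t z ** adjugate (mderiv (\<Phi> s) z)"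
    unfolding curve_def
    using mderiv_mult[OF open_D z hol holomorphic_mat_adjugate[OF hol]]
      mderiv_adjugate[OF open_D z hol] by simp
  also have "\<dots> = \<Phi> t z ** (\<xi> t z - \<xi> s z) ** adjugate (\<Phi> s z)"
    by (simp add: d\<Phi> adjugate_mult adjugate_tracefree[OF trace_\<xi>[OF z]] mult_uminus
        mult_distribs matrix_mul_assoc)
  also have "\<xi> t z - \<xi> s z = cscale (t - s) (leading z)"
    unfolding \<xi>_affine[OF z, of t] \<xi>_affine[OF z, of s] by (simp add: mat2_eq_iff entries algebra_simps)
  finally show ?thesis
    by (simp add: mult_cscale)
qed

lemma det_mderiv_curve: "z \<in> D \<Longrightarrow> det (mderiv (curve s t) z) = 0"
  using det_leading by (simp add: mderiv_curve det_cscale det_mul)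

lemma mderiv_curve_eq_0_iff:
  assumes z: "z \<in> D"
  shows "mderiv (curve s t) z = 0 \<longleftrightarrow> s = t \<or> leading z = 0"
proof -
  have "leading z = adjugate (\<Phi> t z) ** (\<Phi> t z ** leading z ** adjugate (\<Phi> s z)) ** \<Phi> s z"
  proof -
    have "adjugate (\<Phi> t z) ** (\<Phi> t z ** leading z ** adjugate (\<Phi> s z)) ** \<Phi> s z =
        (adjugate (\<Phi> t z) ** \<Phi> t z) ** leading z ** (adjugate (\<Phi> s z) ** \<Phi> s z)"
      by (simp only: matrix_mul_assoc)
    then show ?thesis
      by (simp add: adjugate_inverse det_\<Phi>[OF z])
  qed
  then have "\<Phi> t z ** leading z ** adjugate (\<Phi> s z) = 0 \<longleftrightarrow> leading z = 0"
    by (metis times0_left times0_right)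
  then show ?thesis
    by (auto simp: mderiv_curve[OF z] cscale_eq_0_iff)
qed

text \<open>The reason for the scaling behaviour of the whole family: up to the factor \<open>t - s\<close>, the
  logarithmic derivative is conjugation of the nilpotent coefficient by the frame at \<open>t\<close>,
  and so \<open>s\<close> enters through that factor only.\<close>

lemma log_deriv_curve:
  assumes z: "z \<in> D"
  shows "mderiv (curve s t) z ** adjugate (curve s t z) =
    cscale (t - s) (\<Phi> t z ** leading z ** adjugate (\<Phi> t z))"
proof -
  have "mderiv (curve s t) z ** adjugate (curve s t z) =
      cscale (t - s) (\<Phi> t z ** leading z ** (adjugate (\<Phi> s z) ** \<Phi> s z) ** adjugate (\<Phi> t z))"
    unfolding mderiv_curve[OF z] curve_def by (simp add: mult_cscale adjugate_mult matrix_mul_assoc)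
  then show ?thesis
    by (simp add: adjugate_inverse det_\<Phi>[OF z])
qed

text \<open>Where the nilpotent coefficient vanishes, the null curve and its surface are stationary, for
  all evaluation points at once. Hence a single immersion already makes the surfaces of all
  pairs of distinct evaluation points immersions.\<close>

lemma leading_nonzero:
  assumes z: "z \<in> D"
    and F: "\<And>w. w \<in> D \<Longrightarrow> F w = adjoint_mat (curve s t w) ** curve s t w"
    and inj: "inj (frechet_derivative F (at z))"
  shows "leading z \<noteq> 0"
proof
  assume "leading z = 0"
  then have "mderiv (curve s t) z = 0"
    by (simp add: mderiv_curve_eq_0_iff[OF z])
  then have "((\<lambda>w. adjoint_mat (curve s t w) ** curve s t w) has_derivative
      (\<lambda>v. cscale v (adjoint_mat (curve s t z) ** 0) +
        cscale (cnj v) (adjoint_mat 0 ** curve s t z))) (at z)"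
    using has_derivative_adjoint_mult[OF open_D z holomorphic_curve holomorphic_curve, of s t s t]
    by simp
  moreover have "adjoint_mat 0 = 0"
    by (simp add: mat2_eq_iff entries)
  ultimately have "(F has_derivative (\<lambda>v. 0)) (at z)"
    using has_derivative_cong_open[OF open_D z F] by simp
  then have "frechet_derivative F (at z) = (\<lambda>v. 0)"
    by (simp add: frechet_derivative_at[symmetric])
  then show False
    using inj injD[of "\<lambda>v::complex. 0::cmat2" 0 1] by simp
qed

end

lemma lwr_frame_on_chart:
  assumes "riemann_surface X \<A>" "lwr_frame X \<A> \<Phi>" "c \<in> \<A>"
  shows "lwr_frame_on (chart_image c) (\<lambda>l. in_chart c (\<Phi> l))"
proof
  show "open (chart_image c)"
    using open_chart_image assms by blast
  show "holomorphic_mat (in_chart c (\<Phi> l)) (chart_image c)" for l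
    using assms(2,3) by (auto simp: lwr_frame_def holomorphic_mat_def)
  show "det (in_chart c (\<Phi> l) z) = 1" if "z \<in> chart_image c" for l z
    using assms(2) chart_point[OF assms(1,3) that] by (auto simp: lwr_frame_def in_chart_apply)
  show "lwr_potential_on (chart_image c)
      (\<lambda>l z. matrix_inv (in_chart c (\<Phi> l) z) ** mderiv (in_chart c (\<Phi> l)) z)"
    using assms(2,3) by (auto simp: lwr_frame_def)
qed

definition frame_curve ::
    "(complex \<Rightarrow> 'a \<Rightarrow> cmat2) \<Rightarrow> complex \<Rightarrow> complex \<Rightarrow> 'a \<Rightarrow> cmat2" where
  "frame_curve \<Phi> s t p = \<Phi> t p ** adjugate (\<Phi> s p)"

lemma in_chart_frame_curve:
  assumes "lwr_frame_on D (\<lambda>l. in_chart c (\<Phi> l))"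
  shows "in_chart c (frame_curve \<Phi> s t) = lwr_frame_on.curve (\<lambda>l. in_chart c (\<Phi> l)) s t"
  by (simp add: fun_eq_iff in_chart_apply frame_curve_def lwr_frame_on.curve_def[OF assms])

text \<open>An LWR frame whose nilpotent coefficient vanishes nowhere, the condition under which all
  pairs of distinct evaluation points induce immersions.\<close>

locale immersed_lwr_frame =
  fixes X :: "'a topology" and \<A> :: "'a chart set" and \<Phi> :: "complex \<Rightarrow> 'a \<Rightarrow> cmat2"
  assumes surface: "riemann_surface X \<A>"
    and frame: "lwr_frame X \<A> \<Phi>"
    and leading_nonzero: "c \<in> \<A> \<Longrightarrow> z \<in> chart_image c \<Longrightarrow>
      lwr_frame_on.leading (\<lambda>l. in_chart c (\<Phi> l)) z \<noteq> 0"
begin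

lemma det_\<Phi>: "p \<in> topspace X \<Longrightarrow> det (\<Phi> l p) = 1"
  using frame by (auto simp: lwr_frame_def)

lemma induced_surface_eq:
  assumes "p \<in> topspace X"
  shows "induced_surface \<Phi> s t p = adjoint_mat (frame_curve \<Phi> s t p) ** frame_curve \<Phi> s t p"
  using assms by (simp add: induced_surface_def Let_def frame_curve_def matrix_inv_eq_adjugate det_\<Phi>)

lemma null_frame_curve:
  assumes "s \<noteq> t"
  shows "null_curve X \<A> (frame_curve \<Phi> s t)"
  unfolding null_curve_def
proof (intro conjI ballI allI)
  show "det (frame_curve \<Phi> s t p) = 1" if "p \<in> topspace X" for p
    using that by (simp add: frame_curve_def det_mul det_adjugate det_\<Phi>)
  fix c assume c: "c \<in> \<A>"
  interpret L: lwr_frame_on "chart_image c" "\<lambda>l. in_chart c (\<Phi> l)"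
    using lwr_frame_on_chart[OF surface frame c] .
  note curve = in_chart_frame_curve[OF L.lwr_frame_on_axioms]
  show "(\<lambda>z. in_chart c (frame_curve \<Phi> s t) z $ i $ j) holomorphic_on chart_image c" for i j
    using L.holomorphic_curve by (simp add: curve holomorphic_mat_def)
  fix z assume z: "z \<in> chart_image c"
  show "mderiv (in_chart c (frame_curve \<Phi> s t)) z \<noteq> 0"
    using assms L.mderiv_curve_eq_0_iff[OF z] leading_nonzero[OF c z] by (simp add: curve)
  show "det (mderiv (in_chart c (frame_curve \<Phi> s t)) z) = 0"
    using L.det_mderiv_curve[OF z] by (simp add: curve)
qed

lemma induced_surface_cmc1:
  assumes "s \<noteq> t"
  shows "cmc1_immersion X \<A> (induced_surface \<Phi> s t)"
  using null_curve_cmc1_immersion[OF surface null_frame_curve[OF assms] induced_surface_eq] .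

text \<open>Inverting \<open>\<Phi>\<^sub>t \<Phi>\<^sub>s\<^sup>-\<^sup>1\<close> exchanges the two evaluation points.\<close>

lemma induced_surface_dual:
  assumes "s \<noteq> t"
  shows "is_dual X \<A> (induced_surface \<Phi> s t) (induced_surface \<Phi> t s)"
proof -
  have "matrix_inv (frame_curve \<Phi> s t p) = frame_curve \<Phi> t s p" if "p \<in> topspace X" for p
    using that by (simp add: frame_curve_def matrix_inv_eq_adjugate det_mul det_adjugate det_\<Phi>
        adjugate_mult)
  then show ?thesis
    unfolding is_dual_def
    using induced_surface_cmc1[OF assms] null_frame_curve[OF assms] induced_surface_eq
    by (intro conjI exI[of _ "frame_curve \<Phi> s t"]) auto
qed

text \<open>Moving the denominator point \<open>s\<close> to \<open>t + \<mu> (s - t)\<close> multiplies the factor \<open>t - s\<close> of the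
  logarithmic derivative by \<open>\<mu>\<close>.\<close>

lemma induced_surface_associated:
  assumes "s \<noteq> t"
  shows "complex_associated_family X \<A> (induced_surface \<Phi> s t)
    (\<lambda>\<mu>. induced_surface \<Phi> (t + \<mu> * (s - t)) t)"
  unfolding complex_associated_family_def
proof (intro conjI allI impI ballI induced_surface_cmc1 assms)
  fix \<mu> :: complex assume "\<mu> \<noteq> 0"
  define r where "r = t + \<mu> * (s - t)"
  have "r \<noteq> t"
    using \<open>\<mu> \<noteq> 0\<close> assms by (simp add: r_def)
  then show "t + \<mu> * (s - t) \<noteq> t"
    by (simp add: r_def)
  fix c z assume c: "c \<in> \<A>" and z: "z \<in> chart_image c"
  interpret L: lwr_frame_on "chart_image c" "\<lambda>l. in_chart c (\<Phi> l)"
    using lwr_frame_on_chart[OF surface frame c] .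
  note curve = in_chart_frame_curve[OF L.lwr_frame_on_axioms]
  have S: "null_curve_surface (chart_image c) (L.curve s t) (in_chart c (induced_surface \<Phi> s t))"
    if "s \<noteq> t" for s t
    unfolding curve[symmetric]
    by (rule null_curve_surface_in_chart[OF surface null_frame_curve[OF that] c induced_surface_eq])
  have scale: "null_curve_surface.log_deriv (L.curve r t) w =
      cscale \<mu> (null_curve_surface.log_deriv (L.curve s t) w)" if "w \<in> chart_image c" for w
    unfolding null_curve_surface.log_deriv_def[OF S[OF \<open>r \<noteq> t\<close>]]
      null_curve_surface.log_deriv_def[OF S[OF assms]] L.log_deriv_curve[OF that]
    by (simp add: r_def algebra_simps)
  note scaled = complex_scaling[OF S[OF assms] S[OF \<open>r \<noteq> t\<close>] z scale]
  show "metric_coeff (in_chart c (induced_surface \<Phi> (t + \<mu> * (s - t)) t)) z =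
      of_real ((cmod \<mu>)\<^sup>2) * metric_coeff (in_chart c (induced_surface \<Phi> s t)) z"
    using scaled(1) by (simp add: r_def)
  show "hopf_coeff (in_chart c (induced_surface \<Phi> (t + \<mu> * (s - t)) t)) z =
      \<mu> * hopf_coeff (in_chart c (induced_surface \<Phi> s t)) z"
    using scaled(2) by (simp add: r_def)
qed

lemma induced_surface_dual_associated:
  assumes "s \<noteq> t"
  shows "dual_associated_family X \<A> (induced_surface \<Phi> s t)
    (\<lambda>\<mu>. induced_surface \<Phi> s (s + \<mu> * (t - s)))"
  unfolding dual_associated_family_def
  using assms induced_surface_dual induced_surface_associated[of t s]
  by (intro exI[of _ "induced_surface \<Phi> t s"]
        exI[of _ "\<lambda>\<mu>. induced_surface \<Phi> (s + \<mu> * (t - s)) s"]) auto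

end

lemma immersed_lwr_frameI:
  assumes "riemann_surface X \<A>" "lwr_frame X \<A> \<Phi>" "immersion \<A> (induced_surface \<Phi> s t)"
  shows "immersed_lwr_frame X \<A> \<Phi>"
proof
  fix c z assume c: "c \<in> \<A>" and z: "z \<in> chart_image c"
  interpret L: lwr_frame_on "chart_image c" "\<lambda>l. in_chart c (\<Phi> l)"
    using lwr_frame_on_chart[OF assms(1,2) c] .
  show "L.leading z \<noteq> 0"
  proof (rule L.leading_nonzero[OF z])
    show "inj (frechet_derivative (in_chart c (induced_surface \<Phi> s t)) (at z))"
      using assms(3) c z by (simp add: immersion_def immersion_on_def)
    show "in_chart c (induced_surface \<Phi> s t) w = adjoint_mat (L.curve s t w) ** L.curve s t w"
      if "w \<in> chart_image c" for w
      using L.det_\<Phi>[OF that]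
      by (simp add: induced_surface_def Let_def in_chart_apply L.curve_def matrix_inv_eq_adjugate)
  qed
qed (use assms in auto)

theorem corollary4p6:
  fixes X :: "'a topology" and \<A> :: "'a chart set"
    and \<Phi> :: "complex \<Rightarrow> 'a \<Rightarrow> cmat2" and l0 l1 :: complex
  assumes "riemann_surface X \<A>"
    and "lwr_frame X \<A> \<Phi>"
    and "l0 \<noteq> l1"
    and "immersion \<A> (induced_surface \<Phi> l0 l1)"
  shows "cmc1_immersion X \<A> (induced_surface \<Phi> l0 l1) \<and>
         dual_associated_family X \<A> (induced_surface \<Phi> l0 l1)
           (\<lambda>\<mu>. induced_surface \<Phi> l0 (l0 + \<mu> * (l1 - l0))) \<and>
         bij_betw (\<lambda>\<mu>. l0 + \<mu> * (l1 - l0)) (UNIV - {0}) (UNIV - {l0})"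
proof -
  interpret immersed_lwr_frame X \<A> \<Phi>
    using immersed_lwr_frameI assms by blast
  have "bij_betw (\<lambda>\<mu>. l0 + \<mu> * (l1 - l0)) (UNIV - {0}) (UNIV - {l0})"
    using assms(3) by (intro bij_betwI[where g = "\<lambda>l. (l - l0) / (l1 - l0)"]) auto
  then show ?thesis
    using induced_surface_cmc1 induced_surface_dual_associated assms(3) by blast
qed

end
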